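(* Let $A, B > 1$ be fixed constants such that $\gamma_{A,B} = 1$, where $\gamma_{A,B} = \mathrm{Cap}(\mathbb{D}_1\cup\mathbb{D}_2)$ is the logarithmic capacity of the union of the two disks $$\mathbb{D}_1 = \mathbb{D}\left(\frac{1}{A^2-1}, \frac{A}{A^2-1}\right), \qquad \mathbb{D}_2 = \mathbb{D}\left(\frac{B^2}{1-B^2}, \frac{B}{B^2-1}\right).$$ Then there is a constant $C_1 = C_1(A,B) > 0$ such that there are infinitely many integer-valued polynomials $P$ satisfying $$|P(n)| \le C_1 A^n \ \text{ for all } n\in\mathbb{N}, \quad\text{and}\quad |P(-n)| \le C_1 B^n \ \text{ for all } n\in\mathbb{N}^+.$$
   Context: Notation: $\mathbb{N} = \{0,1,2,\dots\}$, $\mathbb{N}^+ = \{1,2,3,\dots\}$. $\mathbb{D}(a,r)$ is the disk in $\mathbb{C}$ with center $a$ and radius $r$. An integer-valued polynomial is a polynomial (of arbitrary degree) that takes integer values on $\mathbb{N}$ (equivalently, on $\mathbb{Z}$). The logarithmic capacity of a compact set $E\subset\mathbb{C}$ is $$\mathrm{Cap}(E) = \exp\left(-\inf_\nu \int_{E\times E} \log\frac{1}{|z-w|}\, d\nu(z)\, d\nu(w)\right),$$ the infimum being over probability measures $\nu$ supported on $E$; the disks $\mathbb{D}_1,\mathbb{D}_2$ are taken closed when computing the capacity. *)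

theory Defs
  imports "HOL-Probability.Probability" "HOL-Computational_Algebra.Polynomial"
begin

text \<open>
  The kernel \<open>log (1 / |z - w|)\<close> is extended-real valued: it is \<open>\<infinity>\<close> on the diagonal, so that
  measures with atoms have infinite energy (HOL's \<open>ln (1 / 0) = 0\<close> would be wrong here).
\<close>

definition log_kernel :: "complex \<Rightarrow> complex \<Rightarrow> ereal" where
  "log_kernel z w = (if z = w then \<infinity> else ereal (ln (1 / cmod (z - w))))"

text \<open>
  The energy is the extended-real integral of the kernel, i.e. the integral of its positive part
  minus that of its negative part. For a probability measure supported on a bounded set the
  kernel is bounded below, so the second integral is finite and no \<open>\<infinity> - \<infinity>\<close> occurs.
\<close>

definition log_energy :: "complex measure \<Rightarrow> ereal" where
  "log_energy \<nu> =
     enn2ereal (\<integral>\<^sup>+ p. e2ennreal (log_kernel (fst p) (snd p)) \<partial>(\<nu> \<Otimes>\<^sub>M \<nu>))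
   - enn2ereal (\<integral>\<^sup>+ p. e2ennreal (- log_kernel (fst p) (snd p)) \<partial>(\<nu> \<Otimes>\<^sub>M \<nu>))"

definition prob_measures_on :: "complex set \<Rightarrow> complex measure set" where
  "prob_measures_on E = {\<nu>. prob_space \<nu> \<and> sets \<nu> = sets borel \<and> emeasure \<nu> E = 1}"

text \<open>
  Meant for compact \<open>E\<close>. The infimum is then never \<open>-\<infinity>\<close>; the value \<open>\<infinity>\<close> corresponds
  to \<open>exp (-\<infinity>) = 0\<close>.
\<close>

definition log_capacity :: "complex set \<Rightarrow> real" where
  "log_capacity E =
     (let I = (INF \<nu>\<in>prob_measures_on E. log_energy \<nu>)
      in if I = \<infinity> then 0 else exp (- real_of_ereal I))"

definition disk1 :: "real \<Rightarrow> complex set" where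
  "disk1 A = cball (complex_of_real (1 / (A\<^sup>2 - 1))) (A / (A\<^sup>2 - 1))"

definition disk2 :: "real \<Rightarrow> complex set" where
  "disk2 B = cball (complex_of_real (B\<^sup>2 / (1 - B\<^sup>2))) (B / (B\<^sup>2 - 1))"

definition gamma_AB :: "real \<Rightarrow> real \<Rightarrow> real" where
  "gamma_AB A B = log_capacity (disk1 A \<union> disk2 B)"

text \<open>
  Taking real coefficients is no restriction: by interpolation, a complex polynomial with integer
  values on the naturals has rational coefficients.
\<close>

definition integer_valued :: "real poly \<Rightarrow> bool" where
  "integer_valued P \<longleftrightarrow> (\<forall>n::nat. poly P (of_nat n) \<in> \<int>)"

end

theory Submission
  imports Defs "HOL-Complex_Analysis.Complex_Analysis" "Jordan_Normal_Form.Determinant"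
begin

text \<open>
  Write \<open>u = z / (1 - z)\<close>. An integer-valued polynomial \<open>P\<close> is a combination
  \<open>\<Sum>k. b k * (x gchoose k)\<close> with integers \<open>b k\<close>, and its generating function is
  \<open>\<Sum>n. P(n) z^n = (1 + u) q(u)\<close> with \<open>q(u) = \<Sum>k. b k * u^k\<close>. The expansion of the same
  rational function at infinity is \<open>- \<Sum>n\<ge>1. P(-n) z^(-n)\<close>. The circle \<open>|z| = 1/A\<close> is mapped
  to the boundary of \<open>disk1 A\<close>, and \<open>|z| = B\<close> to that of \<open>disk2 B\<close>. So the two required bounds
  say that the suitably normalised Fourier coefficients of \<open>(1 + u) q(u)\<close> on the circles
  \<open>|z| = 1/A\<close> and \<open>|z| = B\<close> are bounded.
  Bounding \<open>q\<close> itself on the disks would be much more than is needed; it is enough to find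
  many integer polynomials \<open>q\<close> of degree below \<open>N\<close> whose mean square on the boundary is \<open>O(N)\<close>
  and to smooth out the individual coefficients by a pigeonhole argument. This takes three
  ingredients.

  Covolume. Let \<open>p k\<close> be the monic orthogonal polynomials for the mean square on the boundary
  and \<open>h k\<close> their squared norms. By Heine's formula (\<open>sum_weighted_det_square\<close>) the product of
  the \<open>h k\<close> for \<open>k < N\<close> is \<open>1 / N!\<close> times a mean of squared Vandermonde determinants with nodes
  on the boundary. Capacity 1 means that no probability measure on the disks has negative energy;
  applied to \<open>N\<close> nodes that are pushed inside by \<open>O(1/N)\<close> and smeared over circles of radius of
  order \<open>1/N\<close>, this bounds every squared Vandermonde determinant by \<open>(\<kappa> N)^N\<close>
  (\<open>two_disks_vandermonde_le\<close>). The factor \<open>1 / N!\<close> absorbs \<open>N^N\<close>, so the product of the \<open>h k\<close>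
  is at most \<open>C^N\<close>.

  Lattice points. The polynomials with integer coefficients form a lattice that is unitriangular
  in the basis \<open>p k\<close>, so boxes with sides \<open>s k\<close> contain about \<open>\<Prod>k. s k\<close> of them
  (\<open>many_integer_polys_in_box\<close>). With \<open>s k = sqrt (R / h k)\<close> the mean square is at most \<open>R N\<close>
  and the number is at least \<open>T^N\<close>, where \<open>T\<close> is as large as desired when \<open>R\<close> is large.

  Pigeonhole. Only \<open>O(N)\<close> of the values \<open>P(n)\<close> matter, since a polynomial of degree below \<open>N\<close>
  grows too slowly to violate the bounds for the first time at a late argument
  (\<open>newton_sequence_control\<close>). Divide these \<open>O(N)\<close> weighted values by a multiple of \<open>sqrt R\<close> and
  round them to integers: the resulting integer vectors have \<open>l\<^sup>1\<close>-norm at most \<open>N\<close>, so there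
  are at most \<open>c^N\<close> of them, with \<open>c\<close> independent of \<open>R\<close>. Choosing \<open>T = 2 * c\<close> leaves \<open>2^N\<close>
  polynomials with the same rounded values. Their differences satisfy the bounds with a constant
  that does not depend on \<open>N\<close>, and as \<open>N\<close> grows there are infinitely many of them.
\<close>

hide_const (open) Determinants.det Order.top

section \<open>Mean values of the logarithm on a circle\<close>

text \<open>
  The mean value property of the holomorphic function \<open>w \<mapsto> Ln (1 - r * w)\<close>, which vanishes
  at the origin.
\<close>

lemma ln_circle_mean_inside:
  fixes r :: complex
  assumes "cmod r < 1"
  shows "((\<lambda>t. ln (cmod (1 - r * cis (2 * pi * t)))) has_integral 0) {0..1}"
proof -
  have re: "Re (1 - r * w) > 0" if "w \<in> cball 0 1" for w
  proof -
    have "cmod (r * w) \<le> cmod r * 1"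
      using that mult_left_mono[of "cmod w" 1 "cmod r"] by (simp add: norm_mult)
    moreover have "Re (r * w) \<le> cmod (r * w)" by (rule complex_Re_le_cmod)
    ultimately show ?thesis using assms by simp
  qed
  have nz: "1 - r * w \<noteq> 0" if "w \<in> cball 0 1" for w
  proof
    assume "1 - r * w = 0"
    thus False using re[OF that] by (simp only: zero_complex.sel)
  qed
  have hol: "(\<lambda>w. Ln (1 - r * w)) holomorphic_on cball 0 1"
    by (intro holomorphic_intros) (use re in \<open>auto simp: complex_nonpos_Reals_iff not_le\<close>)
  have "((\<lambda>u. Ln (1 - r * u) / (u - 0)) has_contour_integral 2 * of_real pi * \<i> * Ln (1 - r * 0))
          (circlepath 0 1)"
    by (rule Cauchy_integral_circlepath_simple[OF hol]) auto
  hence "((\<lambda>t. Ln (1 - r * circlepath 0 1 t) / circlepath 0 1 t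
            * vector_derivative (circlepath 0 1) (at t within {0..1})) has_integral 0) {0..1}"
    by (simp add: has_contour_integral_def)
  hence "((\<lambda>t. Ln (1 - r * cis (2 * pi * t)) * (2 * of_real pi * \<i>)) has_integral 0) {0..1}"
  proof (rule has_integral_eq[rotated])
    fix t :: real assume t: "t \<in> {0..1}"
    have e: "exp (2 * of_real pi * \<i> * of_real t) = cis (2 * pi * t)"
      by (simp add: cis_conv_exp mult_ac)
    show "Ln (1 - r * circlepath 0 1 t) / circlepath 0 1 t
            * vector_derivative (circlepath 0 1) (at t within {0..1}) =
          Ln (1 - r * cis (2 * pi * t)) * (2 * of_real pi * \<i>)"
      using t by (simp add: vector_derivative_circlepath01 e)(simp add: circlepath e)
  qed
  from has_integral_mult_left[OF this, of "1 / (2 * of_real pi * \<i>)"]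
  have "((\<lambda>t. Ln (1 - r * cis (2 * pi * t))) has_integral 0) {0..1}"
    by simp
  from has_integral_linear[OF this bounded_linear_Re]
  have "((\<lambda>t. Re (Ln (1 - r * cis (2 * pi * t)))) has_integral 0) {0..1}"
    by (simp add: o_def)
  thus ?thesis
  proof (rule has_integral_eq[rotated])
    fix t :: real assume "t \<in> {0..1}"
    have "1 - r * cis (2 * pi * t) \<noteq> 0" by (rule nz) simp
    thus "Re (Ln (1 - r * cis (2 * pi * t))) = ln (cmod (1 - r * cis (2 * pi * t)))" by (rule Re_Ln)
  qed
qed

lemma ln_circle_mean:
  fixes z :: complex and \<rho> :: real
  assumes "\<rho> > 0" "cmod z \<noteq> \<rho>"
  shows "((\<lambda>t. ln (cmod (z - \<rho> * cis (2 * pi * t)))) has_integral ln (max (cmod z) \<rho>)) {0..1}"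
proof (cases "cmod z < \<rho>")
  case True
  have "cmod (cnj (z / \<rho>)) < 1" using True assms by (simp add: norm_divide)
  note m = ln_circle_mean_inside[OF this]
  have eq: "cmod (z - \<rho> * cis (2 * pi * t)) = \<rho> * cmod (1 - cnj (z / \<rho>) * cis (2 * pi * t))" for t
  proof -
    define c where "c = cis (2 * pi * t)"
    have cc: "c * cnj c = 1" by (simp add: c_def cis_cnj cis_mult)
    have "- \<rho> * c * cnj (1 - cnj (z / \<rho>) * c) = - \<rho> * c + (\<rho> * (z / \<rho>)) * (c * cnj c)"
      by (simp add: algebra_simps)
    also have "\<dots> = z - \<rho> * c" using assms by (simp add: cc)
    finally have "z - \<rho> * c = - \<rho> * c * cnj (1 - cnj (z / \<rho>) * c)" ..
    thus ?thesis using assms unfolding c_def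
      by (simp only: norm_mult complex_mod_cnj norm_cis norm_minus_cancel norm_of_real)
  qed
  have pos: "cmod (1 - cnj (z / \<rho>) * cis (2 * pi * t)) > 0" for t
  proof -
    have "cmod (cnj (z / \<rho>) * cis (2 * pi * t)) < 1"
      using True assms by (simp add: norm_mult norm_divide)
    hence "cnj (z / \<rho>) * cis (2 * pi * t) \<noteq> 1" by (metis norm_one less_irrefl)
    thus ?thesis by simp
  qed
  have lneq: "ln (cmod (z - \<rho> * cis (2 * pi * t))) = ln \<rho> + ln (cmod (1 - cnj (z / \<rho>) * cis (2 * pi * t)))" for t
    unfolding eq by (rule ln_mult_pos[OF assms(1) pos])
  have "((\<lambda>t. ln \<rho> + ln (cmod (1 - cnj (z / \<rho>) * cis (2 * pi * t)))) has_integral ln \<rho> + 0) {0..1}"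
    using has_integral_add[OF has_integral_const_real[of "ln \<rho>" 0 1] m] by simp
  moreover have "ln (max (cmod z) \<rho>) = ln \<rho> + 0" using True by simp
  ultimately show ?thesis
    by (simp only: lneq)
next
  case False
  hence gt: "cmod z > \<rho>" using assms by auto
  hence z0: "z \<noteq> 0" using assms by auto
  have lt: "cmod (\<rho> / z) < 1"
  proof -
    have "cmod (\<rho> / z) = \<rho> / cmod z" using assms(1) by (simp add: norm_divide)
    also have "\<dots> < 1" using gt assms(1) by (subst divide_less_eq_1_pos) auto
    finally show ?thesis .
  qed
  note m = ln_circle_mean_inside[OF lt]
  have eq: "cmod (z - \<rho> * cis (2 * pi * t)) = cmod z * cmod (1 - (\<rho> / z) * cis (2 * pi * t))" for t
  proof -
    have "z - \<rho> * cis (2 * pi * t) = z * (1 - (\<rho> / z) * cis (2 * pi * t))"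
      using z0 by (simp only: right_diff_distrib mult_1_right mult.assoc[symmetric] nonzero_mult_div_cancel_left
        times_divide_eq_right) simp
    thus ?thesis by (simp only: norm_mult)
  qed
  have pos: "cmod (1 - (\<rho> / z) * cis (2 * pi * t)) > 0" for t
  proof -
    have "cmod ((\<rho> / z) * cis (2 * pi * t)) < 1"
      using lt by (simp only: norm_mult norm_cis mult_1_right)
    hence "(\<rho> / z) * cis (2 * pi * t) \<noteq> 1" by (metis norm_one less_irrefl)
    thus ?thesis by simp
  qed
  have lneq: "ln (cmod (z - \<rho> * cis (2 * pi * t))) = ln (cmod z) + ln (cmod (1 - (\<rho> / z) * cis (2 * pi * t)))" for t
    unfolding eq by (rule ln_mult_pos[OF _ pos]) (use z0 in simp)
  have "((\<lambda>t. ln (cmod z) + ln (cmod (1 - (\<rho> / z) * cis (2 * pi * t)))) has_integral ln (cmod z) + 0) {0..1}"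
    using has_integral_add[OF has_integral_const_real[of "ln (cmod z)" 0 1] m] by simp
  moreover have "ln (max (cmod z) \<rho>) = ln (cmod z) + 0" using gt by (simp add: max_def)
  ultimately show ?thesis
    by (simp only: lneq)
qed

text \<open>
  The logarithmic kernel shifted by \<open>L\<close>. On a set whose diameter is at most \<open>exp L\<close> it is
  nonnegative, so that energies become nonnegative integrals and no differences of infinities
  have to be discussed.
\<close>

definition shifted_log :: "real \<Rightarrow> real \<Rightarrow> ennreal" where
  "shifted_log L d = (if d = 0 then \<infinity> else ennreal (L - ln d))"

abbreviation unit_interval :: "real measure" where
  "unit_interval \<equiv> restrict_space lborel {0..1}"

lemma prob_space_unit_interval: "prob_space unit_interval"
  by (rule prob_spaceI) (simp add: emeasure_restrict_space space_restrict_space)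

lemma borel_measurable_cis [measurable]: "cis \<in> borel_measurable borel"
  by (intro borel_measurable_continuous_onI continuous_intros)

lemma borel_measurable_shifted_log [measurable]: "shifted_log L \<in> borel_measurable borel"
  unfolding shifted_log_def by measurable

lemma tendsto_shifted_log:
  assumes "d \<longlonglongrightarrow> d0" "\<And>n. d n > 0" 
  shows "(\<lambda>n. shifted_log L (d n)) \<longlonglongrightarrow> shifted_log L d0"
proof (cases "d0 = 0")
  case True
  have "filterlim d (at_right 0) sequentially"
    using assms True by (auto simp: filterlim_at intro!: always_eventually) (metis less_irrefl)
  hence "filterlim (\<lambda>n. ln (d n)) at_bot sequentially"
    by (rule filterlim_compose[OF ln_at_0])
  hence "filterlim (\<lambda>n. L - ln (d n)) at_top sequentially"
    by (simp add: filterlim_uminus_at_bot filterlim_tendsto_add_at_top[OF tendsto_const] diff_conv_add_uminus del: add_uminus_conv_diff)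
  hence "(\<lambda>n. ennreal (L - ln (d n))) \<longlonglongrightarrow> top"
    by (simp add: ennreal_tendsto_top_eq_at_top)
  thus ?thesis using True assms(2) by (simp add: shifted_log_def less_imp_neq[THEN not_sym])
next
  case False
  hence "(\<lambda>n. ennreal (L - ln (d n))) \<longlonglongrightarrow> ennreal (L - ln d0)"
    by (intro tendsto_intros assms)
  thus ?thesis using False assms(2) by (simp add: shifted_log_def less_imp_neq[THEN not_sym])
qed

lemma circle_potential_off_circle:
  fixes z :: complex and \<rho> L :: real
  assumes "\<rho> > 0" "cmod z + \<rho> \<le> exp L" "cmod z \<noteq> \<rho>"
  shows "(\<integral>\<^sup>+t. shifted_log L (cmod (z - \<rho> * cis (2 * pi * t))) \<partial>unit_interval)
           = ennreal (L - ln (max (cmod z) \<rho>))"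
proof -
  let ?d = "\<lambda>t. cmod (z - \<rho> * cis (2 * pi * t))"
  have pos: "?d t > 0" for t
  proof -
    have "cmod (\<rho> * cis (2 * pi * t)) = \<rho>" using assms by (simp add: norm_mult)
    hence "z \<noteq> \<rho> * cis (2 * pi * t)" using assms(3) by metis
    thus ?thesis by simp
  qed
  have le: "ln (?d t) \<le> L" for t
  proof -
    have "?d t \<le> cmod z + cmod (\<rho> * cis (2 * pi * t))" by (rule norm_triangle_ineq4)
    also have "\<dots> \<le> exp L" using assms by (simp add: norm_mult)
    finally have "ln (?d t) \<le> ln (exp L)" using pos[of t] by (subst ln_le_cancel_iff) auto
    thus ?thesis by simp
  qed
  have "((\<lambda>t. L - ln (?d t)) has_integral (L - ln (max (cmod z) \<rho>))) {0..1}"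
    using has_integral_diff[OF has_integral_const_real[of L 0 1] ln_circle_mean[OF assms(1,3)]] by simp
  from nn_integral_has_integral_lebesgue[OF _ this] le
  have "(\<integral>\<^sup>+t. ennreal (indicator {0..1} t * (L - ln (?d t))) \<partial>lborel) = ennreal (L - ln (max (cmod z) \<rho>))"
    by simp
  moreover have "(\<integral>\<^sup>+t. ennreal (indicator {0..1} t * (L - ln (?d t))) \<partial>lborel)
      = (\<integral>\<^sup>+t. shifted_log L (?d t) \<partial>unit_interval)"
    using pos by (subst nn_integral_restrict_space)
      (auto intro!: nn_integral_cong simp: shifted_log_def less_imp_neq[THEN not_sym] split: split_indicator)
  ultimately show ?thesis by simp
qed

text \<open>
  The potential of the uniform measure on a circle is \<open>- ln (max (cmod z) \<rho>)\<close>. For \<open>z\<close> on the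
  circle, where the integrand has a singularity, an inequality is enough; it follows from Fatou's
  lemma by approaching \<open>z\<close> radially.
\<close>

lemma circle_potential_le:
  fixes z :: complex and \<rho> L :: real
  assumes "\<rho> > 0" "cmod z + \<rho> \<le> exp L"
  shows "(\<integral>\<^sup>+t. shifted_log L (cmod (z - \<rho> * cis (2 * pi * t))) \<partial>unit_interval)
           \<le> ennreal (L - ln (max (cmod z) \<rho>))"
proof (cases "cmod z = \<rho>")
  case False thus ?thesis using circle_potential_off_circle[OF assms] by simp
next
  case True
  \<comment> \<open>radial approach from inside, so that the distances to the circle stay below \<open>exp L\<close>\<close>
  define r where "r n = 1 - 1 / (2 + real n)" for n
  define y where "y n = complex_of_real (r n) * z" for n
  have r: "0 < r n" "r n < 1" for n by (auto simp: r_def field_simps)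
  have yn: "cmod (y n) < \<rho>" for n using r[of n] True assms(1) by (simp add: y_def norm_mult)
  have ylim: "y \<longlonglongrightarrow> z"
  proof -
    have "r \<longlonglongrightarrow> 1 - 0" unfolding r_def
      by (intro tendsto_diff tendsto_const tendsto_divide_0[OF tendsto_const]
            filterlim_at_top_imp_at_infinity filterlim_tendsto_add_at_top[OF tendsto_const] filterlim_real_sequentially)
    hence "(\<lambda>n. complex_of_real (r n) * z) \<longlonglongrightarrow> complex_of_real (1 - 0) * z"
      by (intro tendsto_intros)
    thus ?thesis by (simp add: y_def[abs_def])
  qed
  have pos: "cmod (y n - \<rho> * cis (2 * pi * t)) > 0" for n t
  proof -
    have "cmod (\<rho> * cis (2 * pi * t)) = \<rho>" using assms by (simp add: norm_mult)
    hence "y n \<noteq> \<rho> * cis (2 * pi * t)" using yn[of n] by auto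
    thus ?thesis by simp
  qed
  let ?u = "\<lambda>n t. shifted_log L (cmod (y n - \<rho> * cis (2 * pi * t)))"
  have "(\<lambda>n. ?u n t) \<longlonglongrightarrow> shifted_log L (cmod (z - \<rho> * cis (2 * pi * t)))" for t
    by (intro tendsto_shifted_log tendsto_norm tendsto_diff ylim tendsto_const pos)
  hence lim: "liminf (\<lambda>n. ?u n t) = shifted_log L (cmod (z - \<rho> * cis (2 * pi * t)))" for t
    by (intro lim_imp_Liminf) auto
  have "(\<integral>\<^sup>+t. liminf (\<lambda>n. ?u n t) \<partial>unit_interval) \<le> liminf (\<lambda>n. \<integral>\<^sup>+t. ?u n t \<partial>unit_interval)"
    by (intro nn_integral_liminf measurable_restrict_space1) measurable
  also have "(\<lambda>n. \<integral>\<^sup>+t. ?u n t \<partial>unit_interval) = (\<lambda>n. ennreal (L - ln \<rho>))"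
  proof
    fix n
    have "cmod (y n) + \<rho> \<le> exp L" using yn[of n] assms True by linarith
    moreover have "max (cmod (y n)) \<rho> = \<rho>" using yn[of n] by simp
    ultimately show "(\<integral>\<^sup>+t. ?u n t \<partial>unit_interval) = ennreal (L - ln \<rho>)"
      using circle_potential_off_circle[OF assms(1), of "y n" L] yn[of n] by simp
  qed
  finally show ?thesis by (simp add: lim True Liminf_const)
qed

section \<open>Energy of smeared point configurations\<close>

lemma borel_measurable_log_kernel [measurable]:
  "(\<lambda>p. log_kernel (fst p) (snd p)) \<in> borel_measurable (borel \<Otimes>\<^sub>M borel)"
proof -
  have "(\<lambda>p. log_kernel (fst p) (snd p)) = (\<lambda>p. if cmod (fst p - snd p) = 0 then \<infinity> else ereal (ln (1 / cmod (fst p - snd p))))"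
    by (auto simp: log_kernel_def)
  also have "\<dots> \<in> borel_measurable (borel \<Otimes>\<^sub>M borel)" by measurable
  finally show ?thesis .
qed

text \<open>
  Since \<open>shifted_log\<close> is nonnegative on the set in question, the positive part of the kernel plus
  \<open>L\<close> is the shifted kernel plus the negative part, and the negative part has a finite integral.
  Therefore the energy is the integral of the shifted kernel minus \<open>L\<close>.
\<close>

lemma log_energy_bounds:
  fixes E :: "complex set" and L :: real
  assumes nu: "\<nu> \<in> prob_measures_on E"
    and diam: "\<And>z w. z \<in> E \<Longrightarrow> w \<in> E \<Longrightarrow> cmod (z - w) \<le> exp L" and L: "L \<ge> 0"
  shows log_energy_ge: "- ereal L \<le> log_energy \<nu>"
    and shifted_energy_ge: "0 \<le> log_energy \<nu> \<Longrightarrow>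
          ennreal L \<le> (\<integral>\<^sup>+z. \<integral>\<^sup>+w. shifted_log L (cmod (z - w)) \<partial>\<nu> \<partial>\<nu>)"
proof -
  from nu have ps: "prob_space \<nu>" and sets[measurable_cong]: "sets \<nu> = sets borel" and em: "emeasure \<nu> E = 1"
    by (auto simp: prob_measures_on_def)
  interpret prob_space \<nu> by (rule ps)
  interpret P: pair_prob_space \<nu> \<nu> ..
  have Es: "E \<in> sets \<nu>" using em by (metis emeasure_notin_sets zero_neq_one)
  have "emeasure (\<nu> \<Otimes>\<^sub>M \<nu>) (E \<times> E) = 1"
    using Es em by (simp add: emeasure_pair_measure_Times)
  hence AE: "AE p in \<nu> \<Otimes>\<^sub>M \<nu>. p \<in> E \<times> E"
    using Es by (intro P.AE_prob_1) (auto simp: P.emeasure_eq_measure one_ennreal.rep_eq)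
  let ?k = "\<lambda>p. log_kernel (fst p) (snd p)"
  define Pos where "Pos = (\<integral>\<^sup>+p. e2ennreal (?k p) \<partial>(\<nu> \<Otimes>\<^sub>M \<nu>))"
  define Neg where "Neg = (\<integral>\<^sup>+p. e2ennreal (- ?k p) \<partial>(\<nu> \<Otimes>\<^sub>M \<nu>))"
  define S where "S = (\<integral>\<^sup>+p. shifted_log L (cmod (fst p - snd p)) \<partial>(\<nu> \<Otimes>\<^sub>M \<nu>))"
  have energy: "log_energy \<nu> = enn2ereal Pos - enn2ereal Neg"
    by (simp add: log_energy_def Pos_def Neg_def)
  have ker[measurable]: "?k \<in> borel_measurable (\<nu> \<Otimes>\<^sub>M \<nu>)"
    using borel_measurable_log_kernel sets by (metis measurable_cong_sets sets_pair_measure_cong)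
  have kernel: "e2ennreal (- ?k p) \<le> ennreal L"
      "e2ennreal (?k p) + ennreal L = shifted_log L (cmod (fst p - snd p)) + e2ennreal (- ?k p)"
    if p: "p \<in> E \<times> E" for p
  proof -
    define d where "d = cmod (fst p - snd p)"
    have dL: "d \<le> exp L" unfolding d_def using p by (intro diam) auto
    show "e2ennreal (- ?k p) \<le> ennreal L"
        "e2ennreal (?k p) + ennreal L = shifted_log L (cmod (fst p - snd p)) + e2ennreal (- ?k p)"
    proof (atomize(full), cases "d = 0")
      case True
      hence eq: "fst p = snd p" by (simp add: d_def)
      hence k: "?k p = \<infinity>" by (simp add: log_kernel_def)
      show "e2ennreal (- ?k p) \<le> ennreal L \<and>
         e2ennreal (?k p) + ennreal L = shifted_log L (cmod (fst p - snd p)) + e2ennreal (- ?k p)"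
        unfolding k using eq by (simp add: shifted_log_def e2ennreal_neg e2ennreal_infty)
    next
      case False
      hence d0: "d > 0" by (simp add: d_def)
      hence k: "?k p = ereal (- ln d)" by (auto simp: log_kernel_def d_def ln_div)
      have lnd: "ln d \<le> L" using dL d0 by (metis exp_gt_zero ln_exp ln_le_cancel_iff)
      have s: "shifted_log L (cmod (fst p - snd p)) = ennreal (L - ln d)"
        using d0 by (simp add: shifted_log_def d_def)
      have "ennreal (- ln d) + ennreal L = ennreal (L - ln d) + ennreal (ln d)"
      proof (cases "ln d \<ge> 0")
        case True
        thus ?thesis using lnd L by (simp add: ennreal_neg flip: ennreal_plus)
      next
        case False
        thus ?thesis using lnd L by (simp add: ennreal_neg flip: ennreal_plus)
      qed
      thus "e2ennreal (- ?k p) \<le> ennreal L \<and>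
         e2ennreal (?k p) + ennreal L = shifted_log L (cmod (fst p - snd p)) + e2ennreal (- ?k p)"
        unfolding k s using lnd L by (simp add: e2ennreal_ereal ennreal_leI)
    qed
  qed
  have mass: "emeasure (\<nu> \<Otimes>\<^sub>M \<nu>) (space (\<nu> \<Otimes>\<^sub>M \<nu>)) = 1" by (rule P.emeasure_space_1)
  have "Neg \<le> (\<integral>\<^sup>+p. ennreal L \<partial>(\<nu> \<Otimes>\<^sub>M \<nu>))" unfolding Neg_def
    using AE kernel(1) by (intro nn_integral_mono_AE) (auto elim!: eventually_mono)
  hence NegL: "Neg \<le> ennreal L" by (simp add: mass)
  hence NegF: "Neg \<noteq> \<infinity>" by (metis ennreal_less_top infinity_ennreal_def leD)
  have "Pos + ennreal L = (\<integral>\<^sup>+p. e2ennreal (?k p) + ennreal L \<partial>(\<nu> \<Otimes>\<^sub>M \<nu>))"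
    unfolding Pos_def by (subst nn_integral_add) (auto simp: mass)
  also have "\<dots> = (\<integral>\<^sup>+p. shifted_log L (cmod (fst p - snd p)) + e2ennreal (- ?k p) \<partial>(\<nu> \<Otimes>\<^sub>M \<nu>))"
    using AE kernel(2) by (intro nn_integral_cong_AE) (auto elim!: eventually_mono)
  also have "\<dots> = S + Neg"
    unfolding S_def Neg_def by (subst nn_integral_add) auto
  finally have balance: "Pos + ennreal L = S + Neg" .
  have "enn2ereal Neg \<le> ereal L" using NegL L by (metis enn2ereal_ennreal less_eq_ennreal.rep_eq)
  hence "- ereal L \<le> - enn2ereal Neg" by (simp only: ereal_minus_le_minus)
  also have "\<dots> \<le> enn2ereal Pos - enn2ereal Neg"
    by (metis add_increasing enn2ereal_nonneg minus_ereal_def order_refl)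
  finally show "- ereal L \<le> log_energy \<nu>" by (simp add: energy)
  assume "0 \<le> log_energy \<nu>"
  hence "enn2ereal Neg \<le> enn2ereal Pos"
    using \<open>enn2ereal Neg \<le> ereal L\<close> enn2ereal_nonneg[of Neg] unfolding energy
    by (cases "enn2ereal Neg"; cases "enn2ereal Pos") auto
  hence "Neg \<le> Pos" by (simp add: less_eq_ennreal.rep_eq)
  hence "ennreal L + Neg \<le> S + Neg" 
    by (metis add.commute add_right_mono balance)
  hence "ennreal L \<le> S" using NegF
    by (metis add.commute ennreal_add_left_cancel_le infinity_ennreal_def)
  also have "S = (\<integral>\<^sup>+z. \<integral>\<^sup>+w. shifted_log L (cmod (z - w)) \<partial>\<nu> \<partial>\<nu>)"
    unfolding S_def by (subst nn_integral_fst[symmetric]) auto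
  finally show "ennreal L \<le> (\<integral>\<^sup>+z. \<integral>\<^sup>+w. shifted_log L (cmod (z - w)) \<partial>\<nu> \<partial>\<nu>)" .
qed

text \<open>
  The infimum of the energies is not \<open>-\<infinity>\<close> because energies on a bounded set are bounded
  below. This has to be excluded, as \<open>real_of_ereal\<close> maps \<open>-\<infinity>\<close> to \<open>0\<close>, which would also give
  the value 1 for the capacity.
\<close>

lemma log_energy_nonneg:
  fixes E :: "complex set" and L :: real
  assumes cap: "log_capacity E = 1" and nu: "\<nu> \<in> prob_measures_on E"
    and diam: "\<And>z w. z \<in> E \<Longrightarrow> w \<in> E \<Longrightarrow> cmod (z - w) \<le> exp L" and L: "L \<ge> 0"
  shows "0 \<le> log_energy \<nu>"
proof -
  define I where "I = (INF \<nu>\<in>prob_measures_on E. log_energy \<nu>)"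
  have fin: "I \<noteq> \<infinity>" and "exp (- real_of_ereal I) = 1"
    using cap by (auto simp: log_capacity_def I_def Let_def split: if_splits)
  hence zero: "real_of_ereal I = 0" by simp
  have "- ereal L \<le> I" unfolding I_def
    by (intro INF_greatest log_energy_ge[OF _ diam L])
  hence "I \<noteq> - \<infinity>" by auto
  with fin zero have "I = 0" by (metis ereal_real' abs_ereal.elims zero_ereal_def ereal_infinity_cases)
  thus ?thesis using INF_lower[OF nu, of log_energy] by (simp add: I_def)
qed

text \<open>
  The average of the uniform measures on the circles of radius \<open>\<rho>\<close> around \<open>w 0, \<dots>, w (N - 1)\<close>.
  Point masses have infinite energy and have to be replaced by such a spread-out measure.
\<close>

definition smeared :: "nat \<Rightarrow> (nat \<Rightarrow> complex) \<Rightarrow> real \<Rightarrow> complex measure" where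
  "smeared N w \<rho> = distr (measure_pmf (pmf_of_set {..<N}) \<Otimes>\<^sub>M unit_interval) borel
     (\<lambda>(i, t). w i + \<rho> * cis (2 * pi * t))"

lemma measurable_smear:
  fixes w :: "nat \<Rightarrow> complex"
  shows "(\<lambda>(i, t). w i + complex_of_real \<rho> * cis (2 * pi * t)) \<in> borel_measurable (measure_pmf p \<Otimes>\<^sub>M unit_interval)"
proof -
  have "(\<lambda>(i, t). w i + complex_of_real \<rho> * cis (2 * pi * t))
      \<in> borel_measurable (count_space UNIV \<Otimes>\<^sub>M unit_interval)"
    by (rule measurable_pair_measure_countable1) (auto intro!: measurable_restrict_space1)
  thus ?thesis
    by (subst measurable_cong_sets[OF sets_pair_measure_cong[OF sets_measure_pmf_count_space refl] refl])
qed

lemma nn_integral_smeared: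
  assumes "N > 0" and [measurable]: "f \<in> borel_measurable borel"
  shows "(\<integral>\<^sup>+z. f z \<partial>smeared N w \<rho>) =
    (\<Sum>i<N. \<integral>\<^sup>+t. f (w i + \<rho> * cis (2 * pi * t)) \<partial>unit_interval) / of_nat N"
proof -
  interpret U: prob_space unit_interval by (rule prob_space_unit_interval)
  have "(\<integral>\<^sup>+z. f z \<partial>smeared N w \<rho>) =
     (\<integral>\<^sup>+p. f (case p of (i, t) \<Rightarrow> w i + \<rho> * cis (2 * pi * t)) \<partial>(measure_pmf (pmf_of_set {..<N}) \<Otimes>\<^sub>M unit_interval))"
    unfolding smeared_def by (intro nn_integral_distr measurable_smear) simp
  also have "\<dots> = (\<integral>\<^sup>+i. \<integral>\<^sup>+t. f (w i + \<rho> * cis (2 * pi * t)) \<partial>unit_interval \<partial>measure_pmf (pmf_of_set {..<N}))"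
    by (subst U.nn_integral_fst[symmetric]) (auto intro!: measurable_compose[OF measurable_smear])
  also have "\<dots> = (\<Sum>i<N. \<integral>\<^sup>+t. f (w i + \<rho> * cis (2 * pi * t)) \<partial>unit_interval) / of_nat N"
    using assms(1) by (subst nn_integral_pmf_of_set) auto
  finally show ?thesis .
qed

lemma smeared_in_prob_measures_on:
  assumes "N > 0" "\<And>i. i < N \<Longrightarrow> cball (w i) \<rho> \<subseteq> E" "\<rho> \<ge> 0" "E \<in> sets borel"
  shows "smeared N w \<rho> \<in> prob_measures_on E"
proof -
  interpret U: prob_space unit_interval by (rule prob_space_unit_interval)
  interpret PP: pair_prob_space "measure_pmf (pmf_of_set {..<N})" unit_interval ..
  have ps: "prob_space (smeared N w \<rho>)" unfolding smeared_def
    by (rule PP.prob_space_distr) (rule measurable_smear)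
  have sets: "sets (smeared N w \<rho>) = sets borel" by (simp add: smeared_def)
  have mem: "w i + \<rho> * cis (2 * pi * t) \<in> E" if "i < N" for i t
    using assms(2)[OF that] assms(3) by (auto simp: dist_norm norm_mult subset_iff)
  have "emeasure (smeared N w \<rho>) E = (\<integral>\<^sup>+z. indicator E z \<partial>smeared N w \<rho>)"
    using assms(4) sets by simp
  also have "\<dots> = (\<Sum>i<N. \<integral>\<^sup>+t. indicator E (w i + \<rho> * cis (2 * pi * t)) \<partial>unit_interval) / of_nat N"
    using assms by (intro nn_integral_smeared) auto
  also have "(\<Sum>i<N. \<integral>\<^sup>+t. indicator E (w i + \<rho> * cis (2 * pi * t)) \<partial>unit_interval) = (\<Sum>i<N. (1 :: ennreal))"
    using mem by (intro sum.cong) (auto simp: emeasure_restrict_space)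
  also have "\<dots> / of_nat N = 1"
    using assms(1) by (simp add: ennreal_of_nat_eq_real_of_nat divide_ennreal)
  finally show ?thesis using ps sets by (simp add: prob_measures_on_def)
qed

text \<open>
  The mutual energy of two circles is at most that of their centres, because the kernel is
  superharmonic, and it is never more than the self-energy of a circle.
\<close>

lemma pair_potential_le:
  fixes a b :: complex and \<rho> L :: real
  assumes \<rho>: "\<rho> > 0" and big: "cmod (a - b) + 2 * \<rho> \<le> exp L"
  shows "(\<integral>\<^sup>+s. \<integral>\<^sup>+t. shifted_log L (cmod ((a + \<rho> * cis (2 * pi * s)) - (b + \<rho> * cis (2 * pi * t))))
            \<partial>unit_interval \<partial>unit_interval) \<le> ennreal (L - ln (max (cmod (a - b)) \<rho>))"
proof -
  interpret U: prob_space unit_interval by (rule prob_space_unit_interval)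
  define z where "z s = a - b + \<rho> * cis (2 * pi * s)" for s
  have nz: "cmod (z s) \<le> cmod (a - b) + \<rho>" for s
    unfolding z_def by (rule order_trans[OF norm_triangle_ineq]) (use \<rho> in \<open>simp add: norm_mult\<close>)
  have inner: "(\<integral>\<^sup>+t. shifted_log L (cmod ((a + \<rho> * cis (2 * pi * s)) - (b + \<rho> * cis (2 * pi * t))))
            \<partial>unit_interval) \<le> ennreal (L - ln (max (cmod (z s)) \<rho>))" for s
  proof -
    have "(a + \<rho> * cis (2 * pi * s)) - (b + \<rho> * cis (2 * pi * t)) = z s - \<rho> * cis (2 * pi * t)" for t
      by (simp add: z_def)
    moreover have "cmod (z s) + \<rho> \<le> exp L" using nz[of s] big by linarith
    ultimately show ?thesis using circle_potential_le[OF \<rho>, of "z s" L] by (simp only:)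
  qed
  show ?thesis
  proof (cases "cmod (a - b) \<le> \<rho>")
    case True
    have "(\<integral>\<^sup>+s. \<integral>\<^sup>+t. shifted_log L (cmod ((a + \<rho> * cis (2 * pi * s)) - (b + \<rho> * cis (2 * pi * t))))
            \<partial>unit_interval \<partial>unit_interval) \<le> (\<integral>\<^sup>+s. ennreal (L - ln \<rho>) \<partial>unit_interval)"
    proof (rule nn_integral_mono)
      fix s
      have "ln \<rho> \<le> ln (max (cmod (z s)) \<rho>)" using \<rho> by (subst ln_le_cancel_iff) auto
      thus "(\<integral>\<^sup>+t. shifted_log L (cmod ((a + \<rho> * cis (2 * pi * s)) - (b + \<rho> * cis (2 * pi * t))))
            \<partial>unit_interval) \<le> ennreal (L - ln \<rho>)"
        by (intro order_trans[OF inner] ennreal_leI) simp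
    qed
    also have "\<dots> = ennreal (L - ln (max (cmod (a - b)) \<rho>))"
      using True by (simp add: emeasure_restrict_space max_absorb2)
    finally show ?thesis .
  next
    case False
    have zpos: "cmod (z s) > 0" for s
    proof -
      have "cmod (\<rho> * cis (2 * pi * s)) = \<rho>" using \<rho> by (simp add: norm_mult)
      hence "z s \<noteq> 0" using False unfolding z_def
        by (metis add_eq_0_iff norm_minus_cancel order_refl)
      thus ?thesis by simp
    qed
    have "(\<integral>\<^sup>+s. \<integral>\<^sup>+t. shifted_log L (cmod ((a + \<rho> * cis (2 * pi * s)) - (b + \<rho> * cis (2 * pi * t))))
            \<partial>unit_interval \<partial>unit_interval)
          \<le> (\<integral>\<^sup>+s. shifted_log L (cmod ((b - a) - \<rho> * cis (2 * pi * s))) \<partial>unit_interval)"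
    proof (rule nn_integral_mono)
      fix s
      have eq: "cmod ((b - a) - \<rho> * cis (2 * pi * s)) = cmod (z s)"
        unfolding z_def by (subst norm_minus_cancel[symmetric]) (simp add: algebra_simps)
      have "ln (cmod (z s)) \<le> ln (max (cmod (z s)) \<rho>)"
        using zpos[of s] \<rho> by (subst ln_le_cancel_iff) (auto simp: less_max_iff_disj)
      hence "ennreal (L - ln (max (cmod (z s)) \<rho>)) \<le> shifted_log L (cmod (z s))"
        using zpos[of s] by (auto simp: shifted_log_def intro!: ennreal_leI)
      thus "(\<integral>\<^sup>+t. shifted_log L (cmod ((a + \<rho> * cis (2 * pi * s)) - (b + \<rho> * cis (2 * pi * t))))
            \<partial>unit_interval) \<le> shifted_log L (cmod ((b - a) - \<rho> * cis (2 * pi * s)))"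
        unfolding eq by (rule order_trans[OF inner])
    qed
    also have "\<dots> \<le> ennreal (L - ln (max (cmod (b - a)) \<rho>))"
      using big \<rho> by (intro circle_potential_le) (auto simp: norm_minus_commute)
    finally show ?thesis by (simp add: norm_minus_commute)
  qed
qed

text \<open>
  The energy of the smeared measure is nonnegative, while the preceding estimate bounds it by a
  discrete energy of the centres; comparing the two leaves the stated inequality.
\<close>

lemma sum_ln_smeared_nonpos:
  fixes E :: "complex set" and L \<rho> :: real and w :: "nat \<Rightarrow> complex"
  assumes cap: "log_capacity E = 1" and E: "E \<in> sets borel" and L: "L \<ge> 0" and \<rho>: "\<rho> > 0"
    and diam: "\<And>z w. z \<in> E \<Longrightarrow> w \<in> E \<Longrightarrow> cmod (z - w) + 2 * \<rho> \<le> exp L"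
    and N: "N > 0" and w: "\<And>i. i < N \<Longrightarrow> cball (w i) \<rho> \<subseteq> E"
  shows "(\<Sum>i<N. \<Sum>j<N. ln (max (cmod (w i - w j)) \<rho>)) \<le> 0"
proof -
  let ?\<nu> = "smeared N w \<rho>"
  define S where "S = (\<Sum>i<N. \<Sum>j<N. ln (max (cmod (w i - w j)) \<rho>))"
  let ?c = "\<lambda>i t. w i + \<rho> * cis (2 * pi * t)"
  have nu: "?\<nu> \<in> prob_measures_on E"
    using N w \<rho> E by (intro smeared_in_prob_measures_on) auto
  have diam': "cmod (z - w) \<le> exp L" if "z \<in> E" "w \<in> E" for z w
    using diam[OF that] \<rho> by linarith
  have wE: "w i \<in> E" if "i < N" for i using w[OF that] \<rho> by auto
  have ps: "prob_space ?\<nu>" and sets: "sets ?\<nu> = sets borel"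
    using nu by (auto simp: prob_measures_on_def)
  have "ennreal L \<le> (\<integral>\<^sup>+z. \<integral>\<^sup>+v. shifted_log L (cmod (z - v)) \<partial>?\<nu> \<partial>?\<nu>)"
    using shifted_energy_ge[OF nu diam' L] log_energy_nonneg[OF cap nu diam' L] by blast
  also have "\<dots> = (\<integral>\<^sup>+z. (\<Sum>j<N. \<integral>\<^sup>+t. shifted_log L (cmod (z - ?c j t)) \<partial>unit_interval) / of_nat N \<partial>?\<nu>)"
    by (intro nn_integral_cong nn_integral_smeared N) measurable
  also have "\<dots> = (\<Sum>i<N. \<integral>\<^sup>+s. (\<Sum>j<N. \<integral>\<^sup>+t. shifted_log L (cmod (?c i s - ?c j t)) \<partial>unit_interval) / of_nat N
                      \<partial>unit_interval) / of_nat N"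
  proof (intro nn_integral_smeared N)
    interpret U: prob_space unit_interval by (rule prob_space_unit_interval)
    have [measurable]: "(\<lambda>t. cis (2 * pi * t)) \<in> borel_measurable unit_interval"
      by (intro measurable_restrict_space1) measurable
    show "(\<lambda>z. (\<Sum>j<N. \<integral>\<^sup>+t. shifted_log L (cmod (z - ?c j t)) \<partial>unit_interval) / of_nat N)
            \<in> borel_measurable borel"
      by measurable
  qed
  also have "\<dots> = (\<Sum>i<N. (\<Sum>j<N. \<integral>\<^sup>+s. \<integral>\<^sup>+t. shifted_log L (cmod (?c i s - ?c j t)) \<partial>unit_interval \<partial>unit_interval)
                      / of_nat N) / of_nat N"
  proof -
    interpret U: prob_space unit_interval by (rule prob_space_unit_interval)
    have [measurable]: "(\<lambda>t. cis (2 * pi * t)) \<in> borel_measurable unit_interval"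
      by (intro measurable_restrict_space1) measurable
    show ?thesis
      by (simp add: nn_integral_divide nn_integral_sum)
  qed
  also have "\<dots> \<le> (\<Sum>i<N. (\<Sum>j<N. ennreal (L - ln (max (cmod (w i - w j)) \<rho>))) / of_nat N) / of_nat N"
    by (intro divide_right_mono_ennreal sum_mono pair_potential_le \<rho>) (auto intro!: diam wE)
  also have "\<dots> = ennreal ((real N * real N * L - S) / (real N * real N))"
  proof -
    have nn: "0 \<le> L - ln (max (cmod (w i - w j)) \<rho>)" if "i < N" "j < N" for i j
    proof -
      have "max (cmod (w i - w j)) \<rho> \<le> exp L"
        using diam[OF wE[OF that(1)] wE[OF that(2)]] \<rho> norm_ge_zero[of "w i - w j"] by linarith
      hence "ln (max (cmod (w i - w j)) \<rho>) \<le> ln (exp L)" using \<rho> by (subst ln_le_cancel_iff) auto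
      thus ?thesis by simp
    qed
    have "(\<Sum>i<N. (\<Sum>j<N. ennreal (L - ln (max (cmod (w i - w j)) \<rho>))) / of_nat N) / of_nat N
        = ennreal ((\<Sum>i<N. (\<Sum>j<N. L - ln (max (cmod (w i - w j)) \<rho>)) / real N) / real N)"
    proof -
      have div: "ennreal x / of_nat N = ennreal (x / real N)" if "x \<ge> 0" for x
        using that N by (simp add: divide_ennreal ennreal_of_nat_eq_real_of_nat)
      have "(\<Sum>j<N. ennreal (L - ln (max (cmod (w i - w j)) \<rho>))) / of_nat N
          = ennreal ((\<Sum>j<N. L - ln (max (cmod (w i - w j)) \<rho>)) / real N)" if "i < N" for i
        using nn that by (subst sum_ennreal) (auto intro!: div sum_nonneg)
      hence "(\<Sum>i<N. (\<Sum>j<N. ennreal (L - ln (max (cmod (w i - w j)) \<rho>))) / of_nat N)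
          = ennreal (\<Sum>i<N. (\<Sum>j<N. L - ln (max (cmod (w i - w j)) \<rho>)) / real N)"
        using nn by (subst sum_ennreal[symmetric]) (auto intro!: divide_nonneg_nonneg sum_nonneg)
      thus ?thesis
        using nn by (simp only:) (intro div sum_nonneg divide_nonneg_nonneg, auto)
    qed
    also have "(\<Sum>i<N. (\<Sum>j<N. L - ln (max (cmod (w i - w j)) \<rho>)) / real N) / real N
        = (real N * real N * L - S) / (real N * real N)"
      using N by (simp add: S_def sum_subtractf sum_divide_distrib[symmetric] field_simps)
    finally show ?thesis .
  qed
  finally have le: "ennreal L \<le> ennreal ((real N * real N * L - S) / (real N * real N))" .
  show ?thesis
  proof (cases "L = 0")
    case False
    hence "L \<le> (real N * real N * L - S) / (real N * real N)"
      using le L by (simp add: ennreal_le_iff2)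
    thus ?thesis using N by (simp add: S_def field_simps)
  next
    case True
    have "ln (max (cmod (w i - w j)) \<rho>) \<le> 0" if "i < N" "j < N" for i j
    proof -
      have "max (cmod (w i - w j)) \<rho> \<le> exp L"
        using diam[OF wE[OF that(1)] wE[OF that(2)]] \<rho> norm_ge_zero[of "w i - w j"] by linarith
      hence "ln (max (cmod (w i - w j)) \<rho>) \<le> ln (exp L)" using \<rho> by (subst ln_le_cancel_iff) auto
      thus ?thesis using True by simp
    qed
    thus ?thesis by (auto intro!: sum_nonpos)
  qed
qed

lemma double_sum_symmetric:
  fixes f :: "nat \<Rightarrow> nat \<Rightarrow> real"
  assumes "\<And>i j. f i j = f j i"
  shows "(\<Sum>i<N. \<Sum>j<N. f i j) = (\<Sum>i<N. f i i) + 2 * (\<Sum>j<N. \<Sum>i<j. f i j)"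
proof (induction N)
  case (Suc N)
  have "(\<Sum>j<N. f N j) = (\<Sum>j<N. f j N)" by (intro sum.cong assms refl)
  with Suc show ?case by (simp add: sum.distrib algebra_simps)
qed simp

lemma ln_one_minus_half_ge:
  fixes N :: nat
  assumes "N > 0"
  shows "- ln 2 \<le> real N * ln (1 - 1 / (2 * real N))"
proof -
  have q: "1 - 1 / (2 * real N) > 0" using assms by (simp add: field_simps)
  have "1 + real N * (- (1 / (2 * real N))) \<le> (1 + (- (1 / (2 * real N)))) ^ N"
    using assms by (intro Bernoulli_inequality) (auto simp: field_simps)
  hence "1 / 2 \<le> (1 - 1 / (2 * real N)) ^ N" using assms by simp
  hence "ln (1 / 2) \<le> ln ((1 - 1 / (2 * real N)) ^ N)" using q by (subst ln_le_cancel_iff) auto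
  thus ?thesis using q by (simp add: ln_realpow ln_div)
qed

text \<open>
  Each point is moved towards the centre of its own disk by a factor \<open>1 - \<eta>\<close> with \<open>\<eta>\<close> of order
  \<open>1/N\<close>. This makes room for circles of radius \<open>\<rho> = \<eta> * m\<close> inside the disks. All mutual distances
  keep at least the fraction \<open>q = 1 - 1/(2 N)\<close> of their size, where distances between different disks are
  controlled by the gap between the disks, so the \<open>N^2\<close> distances together lose only \<open>q^(N^2)\<close>,
  which is exponential in \<open>N\<close>. The self-energies contribute \<open>\<rho>^(-N)\<close>, which is the source of
  the factor \<open>N^N\<close>.
\<close>

lemma two_disks_vandermonde_le:
  fixes c1 c2 :: complex and r1 r2 :: real
  assumes cap: "log_capacity (cball c1 r1 \<union> cball c2 r2) = 1"
    and r: "r1 > 0" "r2 > 0" and disjoint: "dist c1 c2 > r1 + r2"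
  shows "\<exists>\<kappa>>0. \<forall>N>0. \<forall>z. (\<forall>i<N. z i \<in> cball c1 r1 \<union> cball c2 r2) \<longrightarrow>
           (\<Prod>j<N. \<Prod>i<j. cmod (z j - z i))\<^sup>2 \<le> (\<kappa> * real N) ^ N"
proof -
  define E where "E = cball c1 r1 \<union> cball c2 r2"
  define \<delta> where "\<delta> = dist c1 c2 - r1 - r2"
  have \<delta>: "\<delta> > 0" using disjoint by (simp add: \<delta>_def)
  define k where "k = max 1 ((r1 + r2) / \<delta>)"
  have k: "k \<ge> 1" "r1 + r2 \<le> k * \<delta>" using \<delta> by (auto simp: k_def field_simps max_def)
  define m where "m = min r1 r2"
  have m: "m > 0" "m \<le> r1" "m \<le> r2" using r by (auto simp: m_def)
  define c where "c x = (if x \<in> cball c1 r1 then c1 else c2)" for x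
  define rad where "rad x = (if x \<in> cball c1 r1 then r1 else r2)" for x
  have crad: "dist (c x) x \<le> rad x" "cball (c x) (rad x) \<subseteq> E" "m \<le> rad x" if "x \<in> E" for x
    using that m by (auto simp: c_def rad_def E_def)
  \<comment> \<open>\<open>exp L\<close> exceeds the diameter of \<open>E\<close> plus that of the circles; the summand 1 makes \<open>L \<ge> 0\<close>\<close>
  define L where "L = ln (1 + 2 * m + dist c1 c2 + 2 * r1 + 2 * r2)"
  have expL: "exp L = 1 + 2 * m + dist c1 c2 + 2 * r1 + 2 * r2"
    unfolding L_def using m r by (intro exp_ln) (auto intro!: add_pos_nonneg)
  have L0: "L \<ge> 0" unfolding L_def using m r by (intro ln_ge_zero) auto
  have sameE: "c x = c y \<or> (c x = c1 \<and> c y = c2 \<and> rad x = r1 \<and> rad y = r2)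
          \<or> (c x = c2 \<and> c y = c1 \<and> rad x = r2 \<and> rad y = r1)" for x y
    by (auto simp: c_def rad_def)
  have dE: "dist x y \<le> dist c1 c2 + 2 * r1 + 2 * r2" if "x \<in> E" "y \<in> E" for x y
  proof -
    have "dist x y \<le> dist x (c x) + dist (c x) (c y) + dist (c y) y"
      by metric
    moreover have "rad x \<le> r1 + r2" "rad y \<le> r1 + r2" using r by (auto simp: rad_def)
    moreover have "dist (c x) (c y) \<le> dist c1 c2" by (auto simp: c_def dist_commute)
    ultimately show ?thesis using crad(1)[OF that(1)] crad(1)[OF that(2)] by (simp add: dist_commute)
  qed
  have main: "(\<Prod>j<N. \<Prod>i<j. cmod (z j - z i))\<^sup>2 \<le> (4 * k / m * real N) ^ N"
    if N: "N > 0" and zE: "\<And>i. i < N \<Longrightarrow> z i \<in> E" for N :: nat and z :: "nat \<Rightarrow> complex"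
  proof (cases "inj_on z {..<N}")
    case False
    then obtain i j where ij: "i < j" "j < N" "z i = z j"
      unfolding inj_on_def by (metis lessThan_iff linorder_neqE_nat)
    have zero: "(\<Prod>i<j. cmod (z j - z i)) = 0" using ij by (intro prod_zero bexI[of _ i]) auto
    have "(\<Prod>j<N. \<Prod>i<j. cmod (z j - z i)) = 0"
      using prod_zero[of "{..<N}" "\<lambda>j. \<Prod>i<j. cmod (z j - z i)"] zero ij by blast
    thus ?thesis using k m by (simp only: power2_eq_square mult_zero_left) simp
  next
    case True
    \<comment> \<open>\<open>k\<close> compensates for gaps \<open>\<delta>\<close> that are small in comparison with the radii\<close>
    define \<eta> where "\<eta> = 1 / (2 * k * N)"
    have \<eta>: "\<eta> > 0" "k * \<eta> = 1 / (2 * real N)" using k N by (auto simp: \<eta>_def)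
    have \<eta>1: "\<eta> \<le> k * \<eta>" using k \<eta>(1) by simp
    define q where "q = 1 - 1 / (2 * real N)"
    have q: "q > 0" "q = 1 - k * \<eta>" using N \<eta>(2) by (auto simp: q_def field_simps)
    have q1: "q \<le> 1 - \<eta>" "q \<le> 1" using \<eta>1 \<eta>(1) q(2) by linarith+
    define \<rho> where "\<rho> = \<eta> * m"
    have \<rho>: "\<rho> > 0" using \<eta> m by (simp add: \<rho>_def)
    define w where "w i = z i - of_real \<eta> * (z i - c (z i))" for i
    have \<eta>le: "\<eta> < 1" using q q1 by linarith
    have norm\<eta>: "cmod (of_real (1 - \<eta>)) = 1 - \<eta>" using \<eta>le by (simp only: norm_of_real)
    have wE: "cball (w i) \<rho> \<subseteq> E" if i: "i < N" for i
    proof -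
      have "dist (c (z i)) (w i) = (1 - \<eta>) * dist (c (z i)) (z i)"
      proof -
        have "c (z i) - w i = of_real (1 - \<eta>) * (c (z i) - z i)"
          by (simp add: w_def algebra_simps)
        thus ?thesis by (simp only: dist_norm norm_mult norm\<eta>)
      qed
      also have "\<dots> \<le> (1 - \<eta>) * rad (z i)" using \<eta>le crad(1)[OF zE[OF i]] by (intro mult_left_mono) auto
      finally have d: "dist (c (z i)) (w i) + \<rho> \<le> rad (z i)"
        using mult_left_mono[OF crad(3)[OF zE[OF i]] less_imp_le[OF \<eta>(1)]] by (simp add: \<rho>_def algebra_simps)
      have "cball (w i) \<rho> \<subseteq> cball (c (z i)) (rad (z i))"
        using d by (auto simp: subset_iff intro: order_trans[OF dist_triangle[of _ _ "w i"]])
      thus ?thesis using crad(2)[OF zE[OF i]] by blast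
    qed
    have sep: "q * cmod (z i - z j) \<le> cmod (w i - w j)" if ij: "i < N" "j < N" for i j
    proof (cases "c (z i) = c (z j)")
      case True
      have "w i - w j = of_real (1 - \<eta>) * (z i - z j)" by (simp add: w_def True algebra_simps)
      hence "cmod (w i - w j) = (1 - \<eta>) * cmod (z i - z j)" by (simp only: norm_mult norm\<eta>)
      thus ?thesis using q1 by (simp add: mult_right_mono)
    next
      case False
      hence rr: "rad (z i) + rad (z j) = r1 + r2" and cc: "dist (c (z i)) (c (z j)) = dist c1 c2"
        using sameE[of "z i" "z j"] by (auto simp: dist_commute)
      have "dist (c (z i)) (c (z j)) \<le> dist (c (z i)) (z i) + dist (z i) (z j) + dist (z j) (c (z j))"
        by metric
      hence far: "\<delta> \<le> cmod (z i - z j)"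
        using crad(1)[OF zE[OF ij(1)]] crad(1)[OF zE[OF ij(2)]] rr cc
        by (simp add: \<delta>_def dist_norm norm_minus_commute)
      have "w i - w j = (z i - z j) - (of_real \<eta> * (z i - c (z i)) - of_real \<eta> * (z j - c (z j)))"
        by (simp add: w_def algebra_simps)
      hence "cmod (w i - w j) \<ge> cmod (z i - z j) - cmod (of_real \<eta> * (z i - c (z i)) - of_real \<eta> * (z j - c (z j)))"
        by (metis norm_triangle_ineq2)
      moreover have "cmod (of_real \<eta> * (z i - c (z i)) - of_real \<eta> * (z j - c (z j)))
            \<le> \<eta> * cmod (z i - c (z i)) + \<eta> * cmod (z j - c (z j))"
        using \<eta>(1) by (intro order_trans[OF norm_triangle_ineq4]) (simp add: norm_mult)
      moreover have "\<eta> * cmod (z i - c (z i)) + \<eta> * cmod (z j - c (z j)) \<le> \<eta> * (r1 + r2)"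
        using crad(1)[OF zE[OF ij(1)]] crad(1)[OF zE[OF ij(2)]] \<eta>(1) rr
        by (simp add: distrib_left[symmetric] dist_norm norm_minus_commute)
      moreover have "\<eta> * (r1 + r2) \<le> \<eta> * (k * cmod (z i - z j))"
        using k \<eta>(1) mult_left_mono[OF far, of k] by (intro mult_left_mono) linarith+
      ultimately have "cmod (w i - w j) \<ge> cmod (z i - z j) - \<eta> * (k * cmod (z i - z j))" by linarith
      thus ?thesis by (simp add: q(2) algebra_simps)
    qed
    have zpos: "cmod (z j - z i) > 0" if "i < j" "j < N" for i j
      using True that by (auto simp: inj_on_def) (metis lessThan_iff less_trans less_irrefl)
    define S where "S = (\<Sum>j<N. \<Sum>i<j. ln (cmod (z j - z i)))"
    have mle: "\<rho> \<le> m" using \<eta>le m by (simp add: \<rho>_def)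
    have "(\<Sum>i<N. \<Sum>j<N. ln (max (cmod (w i - w j)) \<rho>)) \<le> 0"
    proof (rule sum_ln_smeared_nonpos[OF _ _ L0 \<rho> _ N wE])
      show "log_capacity E = 1" using cap by (simp add: E_def)
      show "E \<in> sets borel" by (simp add: E_def)
      show "cmod (x - y) + 2 * \<rho> \<le> exp L" if "x \<in> E" "y \<in> E" for x y
        using dE[OF that] mle unfolding expL by (simp add: dist_norm)
    qed
    also have "(\<Sum>i<N. \<Sum>j<N. ln (max (cmod (w i - w j)) \<rho>)) =
        (\<Sum>i<N. ln (max (cmod (w i - w i)) \<rho>)) + 2 * (\<Sum>j<N. \<Sum>i<j. ln (max (cmod (w i - w j)) \<rho>))"
      by (rule double_sum_symmetric) (simp add: norm_minus_commute)
    also have "(\<Sum>i<N. ln (max (cmod (w i - w i)) \<rho>)) = real N * ln \<rho>" using \<rho> by (simp add: max_absorb2)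
    finally have A: "real N * ln \<rho> + 2 * (\<Sum>j<N. \<Sum>i<j. ln (max (cmod (w i - w j)) \<rho>)) \<le> 0" .
    have "(\<Sum>j<N. \<Sum>i<j. ln q + ln (cmod (z j - z i))) \<le> (\<Sum>j<N. \<Sum>i<j. ln (max (cmod (w i - w j)) \<rho>))"
    proof (intro sum_mono)
      fix j i assume "j \<in> {..<N}" "i \<in> {..<j}"
      hence ij: "i < j" "j < N" by auto
      have "ln q + ln (cmod (z j - z i)) = ln (q * cmod (z j - z i))"
        using q zpos[OF ij] by (simp add: ln_mult_pos)
      also have "\<dots> \<le> ln (max (cmod (w i - w j)) \<rho>)"
        using sep[of i j] ij q zpos[OF ij] \<rho> by (subst ln_le_cancel_iff) (auto simp: norm_minus_commute less_max_iff_disj)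
      finally show "ln q + ln (cmod (z j - z i)) \<le> ln (max (cmod (w i - w j)) \<rho>)" .
    qed
    moreover have "(\<Sum>j<N. \<Sum>i<j. ln q + ln (cmod (z j - z i))) = (\<Sum>j<N. real j) * ln q + S"
      by (simp add: S_def sum.distrib sum_distrib_right)
    moreover have "real N * (real N * ln q) \<le> 2 * ((\<Sum>j<N. real j) * ln q)"
    proof -
      have "2 * (\<Sum>j<N. real j) = real N * (real N - 1)" by (induction N) (auto simp: algebra_simps)
      hence "2 * ((\<Sum>j<N. real j) * ln q) = real N * (real N - 1) * ln q" by (metis mult.assoc)
      moreover have "real N * ln q \<le> 0" using q q1 by (intro mult_nonneg_nonpos) auto
      moreover have "real N * (real N - 1) * ln q = real N * (real N * ln q) - real N * ln q"
        by (simp add: algebra_simps)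
      ultimately show ?thesis by linarith
    qed
    moreover have "real N * (- ln 2) \<le> real N * (real N * ln q)"
      using ln_one_minus_half_ge[OF N] unfolding q_def by (intro mult_left_mono) auto
    ultimately have "2 * S \<le> real N * (ln 2 - ln \<rho>)"
      using A by (simp add: algebra_simps)
    also have "ln 2 - ln \<rho> = ln (4 * k / m * real N)"
    proof -
      have "ln 2 - ln \<rho> = ln (2 / \<rho>)" using \<rho> by (simp add: ln_div)
      also have "2 / \<rho> = 4 * k / m * real N" using m k N by (simp add: \<rho>_def \<eta>_def field_simps)
      finally show ?thesis .
    qed
    finally have B: "2 * S \<le> real N * ln (4 * k / m * real N)" .
    define V where "V = (\<Prod>j<N. \<Prod>i<j. cmod (z j - z i))"
    have Vpos: "V > 0" unfolding V_def using zpos by (intro prod_pos) auto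
    have "ln V = (\<Sum>j<N. ln (\<Prod>i<j. cmod (z j - z i)))"
      unfolding V_def using zpos by (intro ln_prod prod_pos) auto
    also have "\<dots> = S" unfolding S_def using zpos by (intro sum.cong ln_prod) auto
    finally have "ln (V\<^sup>2) = 2 * S" using Vpos by (simp add: ln_realpow)
    also have "\<dots> \<le> ln ((4 * k / m * real N) ^ N)" using B k m N by (simp add: ln_realpow)
    finally show ?thesis using Vpos k m N unfolding V_def[symmetric] by (subst (asm) ln_le_cancel_iff) auto
  qed
  show ?thesis
    by (intro exI[of _ "4 * k / m"]) (use main k m in \<open>auto simp: E_def\<close>)
qed

section \<open>Vandermonde determinants and Heine's formula\<close>

abbreviation cpoly :: "real poly \<Rightarrow> complex poly" where
  "cpoly \<equiv> map_poly complex_of_real"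

text \<open>
  Expanding along the last row shows that the determinant is a polynomial in the last node. It
  vanishes at the other nodes, and its leading coefficient is the determinant of one size less.
\<close>

lemma det_polys_eq_vandermonde:
  fixes p :: "nat \<Rightarrow> complex poly" and z :: "nat \<Rightarrow> complex"
  assumes deg: "\<And>k. degree (p k) = k" and monic: "\<And>k. lead_coeff (p k) = 1"
  shows "Determinant.det (mat N N (\<lambda>(i, j). poly (p j) (z i))) = (\<Prod>b<N. \<Prod>a<b. z b - z a)"
proof (induction N)
  case 0
  show ?case by (simp add: Determinant.det_def)
next
  case (Suc N)
  define M where "M = mat (Suc N) (Suc N) (\<lambda>(i, j). poly (p j) (z i))"
  have M: "M \<in> carrier_mat (Suc N) (Suc N)" by (simp add: M_def)
  define D where "D = (\<Prod>b<N. \<Prod>a<b. z b - z a)"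
  \<comment> \<open>the determinant as a polynomial in the last node\<close>
  define c where "c j = cofactor M N j" for j
  define f where "f = (\<Sum>j<Suc N. Polynomial.smult (c j) (p j))"
  have cN: "c N = D"
  proof -
    have "mat_delete M N N = mat N N (\<lambda>(i, j). poly (p j) (z i))"
      by (rule eq_matI) (auto simp: mat_delete_def M_def)
    thus ?thesis using Suc.IH by (simp add: c_def cofactor_def D_def)
  qed
  have detM: "Determinant.det M = poly f (z N)"
    by (subst laplace_expansion_row[OF M, of N])
       (auto simp: f_def poly_sum c_def M_def mult.commute intro!: sum.cong)
  have root: "poly f (z i) = 0" if "i < N" for i
  proof -
    define M' where "M' = mat (Suc N) (Suc N) (\<lambda>(k, j). poly (p j) (if k = N then z i else z k))"
    have M': "M' \<in> carrier_mat (Suc N) (Suc N)" by (simp add: M'_def)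
    have "mat_delete M' N j = mat_delete M N j" for j
      by (rule eq_matI) (auto simp: mat_delete_def M_def M'_def)
    hence "Determinant.det M' = poly f (z i)"
      by (subst laplace_expansion_row[OF M', of N])
         (auto simp: f_def poly_sum c_def cofactor_def M'_def mult.commute intro!: sum.cong)
    moreover have "Determinant.det M' = 0"
      using that by (intro det_identical_rows[OF M', of i N]) (auto simp: M'_def intro!: eq_vecI)
    ultimately show ?thesis by simp
  qed
  have "poly f (z N) = D * (\<Prod>a<N. z N - z a)"
  proof (cases "inj_on z {..<N}")
    case False
    then obtain i j where ij: "i < j" "j < N" "z i = z j"
      unfolding inj_on_def by (metis lessThan_iff linorder_neqE_nat)
    have "row M i = row M j" using ij by (auto simp: M_def intro!: eq_vecI)
    hence "Determinant.det M = 0" using ij by (intro det_identical_rows[OF M, of i j]) auto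
    moreover have "(\<Prod>a<j. z j - z a) = 0" using ij by (intro prod_zero bexI[of _ i]) auto
    hence "D = 0" unfolding D_def using prod_zero[of "{..<N}" "\<lambda>b. \<Prod>a<b. z b - z a"] ij by blast
    ultimately show ?thesis using detM by simp
  next
    case True
    \<comment> \<open>the leading terms cancel, leaving fewer than \<open>N\<close> roots unless \<open>g\<close> is zero\<close>
    define g where "g = f - Polynomial.smult D (\<Prod>a<N. [:- z a, 1:])"
    have deg1: "degree (\<Prod>a<N. [:- z a, 1:]) = N"
      by (subst degree_prod_eq_sum_degree) auto
    have lead1: "coeff (\<Prod>a<N. [:- z a, 1:]) N = 1"
      using lead_coeff_prod[of "\<lambda>a. [:- z a, 1:]" "{..<N}"] deg1 by simp
    have "coeff f N = D"
    proof -
      have "coeff f N = (\<Sum>j<Suc N. c j * coeff (p j) N)" by (simp add: f_def coeff_sum)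
      also have "\<dots> = (\<Sum>j<Suc N. if j = N then D else 0)"
        using monic[of N] by (intro sum.cong refl) (auto simp: cN deg coeff_eq_0)
      finally show ?thesis by simp
    qed
    moreover have "degree f \<le> N" unfolding f_def
      by (intro degree_sum_le) (auto simp: deg intro: order_trans[OF degree_smult_le])
    ultimately have gdeg: "coeff g k = 0" if "k \<ge> N" for k
      using that lead1 deg1 by (cases "k = N") (auto simp: g_def coeff_eq_0)
    have groot: "poly g (z i) = 0" if "i < N" for i
      using root[OF that] that by (auto simp: g_def poly_prod intro!: prod_zero)
    have "g = 0"
    proof (rule ccontr)
      assume "g \<noteq> 0"
      hence "degree g < N" using gdeg by (metis leading_coeff_0_iff not_le)
      moreover have "card (z ` {..<N}) \<le> card {x. poly g x = 0}"
        using groot \<open>g \<noteq> 0\<close> by (intro card_mono poly_roots_finite) auto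
      moreover have "card {x. poly g x = 0} \<le> degree g" using \<open>g \<noteq> 0\<close> by (rule card_poly_roots_bound)
      ultimately show False using True by (simp add: card_image)
    qed
    thus ?thesis by (simp add: g_def poly_prod)
  qed
  thus ?case using detM by (simp add: M_def D_def)
qed

text \<open>
  Heine's formula for a discrete measure. In the Leibniz expansion of the squared determinant, the
  sum over all node tuples factors into inner products of the functions with indices \<open>\<sigma> a\<close> and
  \<open>\<tau> a\<close>, so only the terms with \<open>\<sigma> = \<tau>\<close> survive.
\<close>

lemma sum_weighted_det_square:
  fixes f :: "nat \<Rightarrow> 'i \<Rightarrow> complex" and w :: "'i \<Rightarrow> real" and h :: "nat \<Rightarrow> real"
  assumes I: "finite I"
    and orth: "\<And>j k. j < N \<Longrightarrow> k < N \<Longrightarrow>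
        (\<Sum>i\<in>I. of_real (w i) * (f j i * cnj (f k i))) = (if j = k then of_real (h j) else 0)"
  shows "(\<Sum>g\<in>{0..<N} \<rightarrow>\<^sub>E I. (\<Prod>a<N. w (g a)) * (cmod (Determinant.det (mat N N (\<lambda>(a, j). f j (g a)))))\<^sup>2)
           = fact N * (\<Prod>k<N. h k)"
proof -
  let ?P = "{\<sigma>. \<sigma> permutes {0..<N}}"
  define s :: "(nat \<Rightarrow> nat) \<Rightarrow> complex" where "s \<sigma> = of_int (sign \<sigma>)" for \<sigma>
  have det: "Determinant.det (mat N N (\<lambda>(a, j). f j (g a))) = (\<Sum>\<sigma>\<in>?P. s \<sigma> * (\<Prod>a = 0..<N. f (\<sigma> a) (g a)))"
    for g :: "nat \<Rightarrow> 'i"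
    unfolding s_def by (subst det_def') (auto intro!: sum.cong prod.cong dest: permutes_in_image)
  have fin: "finite ?P" by (rule finite_permutations) simp
  have expand: "complex_of_real ((\<Prod>a<N. w (g a)) * (cmod (Determinant.det (mat N N (\<lambda>(a, j). f j (g a)))))\<^sup>2)
      = (\<Sum>\<sigma>\<in>?P. \<Sum>\<tau>\<in>?P. s \<sigma> * s \<tau> * (\<Prod>a = 0..<N. of_real (w (g a)) * (f (\<sigma> a) (g a) * cnj (f (\<tau> a) (g a)))))"
    for g :: "nat \<Rightarrow> 'i"
  proof -
    have "complex_of_real ((cmod (Determinant.det (mat N N (\<lambda>(a, j). f j (g a)))))\<^sup>2)
      = (\<Sum>\<sigma>\<in>?P. s \<sigma> * (\<Prod>a = 0..<N. f (\<sigma> a) (g a))) * cnj (\<Sum>\<tau>\<in>?P. s \<tau> * (\<Prod>a = 0..<N. f (\<tau> a) (g a)))"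
      unfolding det[symmetric] by (rule complex_norm_square)
    also have "\<dots> = (\<Sum>\<sigma>\<in>?P. \<Sum>\<tau>\<in>?P. s \<sigma> * s \<tau> * (\<Prod>a = 0..<N. f (\<sigma> a) (g a) * cnj (f (\<tau> a) (g a))))"
      by (simp add: sum_product prod.distrib s_def mult_ac)
    finally have eq: "complex_of_real ((cmod (Determinant.det (mat N N (\<lambda>(a, j). f j (g a)))))\<^sup>2) = \<dots>" .
    show ?thesis
      unfolding of_real_mult eq
      by (simp add: sum_distrib_left prod.distrib atLeast0LessThan mult_ac)
  qed
  have ortho: "(\<Prod>a = 0..<N. \<Sum>i\<in>I. of_real (w i) * (f (\<sigma> a) i * cnj (f (\<tau> a) i)))
      = (if \<sigma> = \<tau> then of_real (\<Prod>k<N. h k) else 0)" if \<sigma>: "\<sigma> \<in> ?P" and \<tau>: "\<tau> \<in> ?P" for \<sigma> \<tau>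
  proof -
    have in_range: "\<sigma> a < N" "\<tau> a < N" if "a < N" for a
      using permutes_in_image[of \<sigma> "{0..<N}" a] permutes_in_image[of \<tau> "{0..<N}" a] \<sigma> \<tau> that by auto
    have "(\<Prod>a = 0..<N. \<Sum>i\<in>I. of_real (w i) * (f (\<sigma> a) i * cnj (f (\<tau> a) i)))
       = (\<Prod>a = 0..<N. if \<sigma> a = \<tau> a then complex_of_real (h (\<sigma> a)) else 0)"
      using in_range by (intro prod.cong refl orth) auto
    also have "\<dots> = (if \<sigma> = \<tau> then of_real (\<Prod>k<N. h k) else 0)"
    proof (cases "\<sigma> = \<tau>")
      case True
      have "(\<Prod>a\<in>{0..<N}. complex_of_real (h (\<sigma> a))) = (\<Prod>k\<in>{0..<N}. complex_of_real (h k))"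
        using prod.permute[of \<sigma> "{0..<N}" "\<lambda>k. complex_of_real (h k)"] \<sigma> by (simp add: o_def)
      thus ?thesis using True by (simp add: atLeast0LessThan)
    next
      case False
      have "\<exists>a\<in>{0..<N}. \<sigma> a \<noteq> \<tau> a"
      proof (rule ccontr)
        assume "\<not> ?thesis"
        hence "\<sigma> a = \<tau> a" for a
          using \<sigma> \<tau> by (cases "a \<in> {0..<N}") (auto simp: permutes_def)
        thus False using False by auto
      qed
      thus ?thesis using False by (auto intro!: prod_zero)
    qed
    finally show ?thesis .
  qed
  have "complex_of_real (\<Sum>g\<in>{0..<N} \<rightarrow>\<^sub>E I. (\<Prod>a<N. w (g a)) * (cmod (Determinant.det (mat N N (\<lambda>(a, j). f j (g a)))))\<^sup>2)
     = (\<Sum>g\<in>{0..<N} \<rightarrow>\<^sub>E I. \<Sum>\<sigma>\<in>?P. \<Sum>\<tau>\<in>?P. s \<sigma> * s \<tau> *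
          (\<Prod>a = 0..<N. of_real (w (g a)) * (f (\<sigma> a) (g a) * cnj (f (\<tau> a) (g a)))))"
    unfolding of_real_sum expand ..
  also have "\<dots> = (\<Sum>\<sigma>\<in>?P. \<Sum>\<tau>\<in>?P. s \<sigma> * s \<tau> * (\<Sum>g\<in>{0..<N} \<rightarrow>\<^sub>E I.
          (\<Prod>a = 0..<N. of_real (w (g a)) * (f (\<sigma> a) (g a) * cnj (f (\<tau> a) (g a))))))"
    by (subst sum.swap, intro sum.cong refl, subst sum.swap, simp add: sum_distrib_left)
  also have "\<dots> = (\<Sum>\<sigma>\<in>?P. \<Sum>\<tau>\<in>?P. s \<sigma> * s \<tau> * (if \<sigma> = \<tau> then of_real (\<Prod>k<N. h k) else 0))"
    by (intro sum.cong refl arg_cong2[of _ _ _ _ "(*)"])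
       (subst prod_sum_PiE[symmetric], auto simp: I ortho)
  also have "\<dots> = (\<Sum>\<sigma>\<in>?P. s \<sigma> * s \<sigma> * of_real (\<Prod>k<N. h k))"
    using fin by (intro sum.cong refl) (simp add: if_distrib[of "\<lambda>x. _ * x"] cong: if_cong)
  also have "\<dots> = (\<Sum>\<sigma>\<in>?P. of_real (\<Prod>k<N. h k))"
    by (intro sum.cong refl) (simp add: s_def flip: of_int_mult)
  also have "\<dots> = complex_of_real (fact N * (\<Prod>k<N. h k))"
    using card_permutations[of "{0..<N}" N] by simp
  finally show ?thesis by (simp only: of_real_eq_iff)
qed

section \<open>Monic orthogonal polynomials\<close>

text \<open>
  The Gram-Schmidt process, applied to the monomials. The inner product is only assumed definite
  below degree \<open>N\<close>, as is appropriate for a measure with finitely many atoms.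
\<close>

lemma orthogonal_monic_polys_exist:
  fixes ip :: "real poly \<Rightarrow> real poly \<Rightarrow> real"
  assumes add: "\<And>f g h. ip (f + g) h = ip f h + ip g h"
    and smult: "\<And>c f h. ip (Polynomial.smult c f) h = c * ip f h"
    and sym: "\<And>f g. ip f g = ip g f"
    and pos: "\<And>f. f \<noteq> 0 \<Longrightarrow> degree f < N \<Longrightarrow> ip f f > 0"
  shows "\<exists>p. (\<forall>k. degree (p k) = k \<and> lead_coeff (p k) = 1) \<and> (\<forall>j<N. \<forall>k<N. j \<noteq> k \<longrightarrow> ip (p j) (p k) = 0)"
proof -
  have sum: "ip (\<Sum>j\<in>A. f j) h = (\<Sum>j\<in>A. ip (f j) h)" for A :: "nat set" and f h
  proof -
    have "ip 0 h = 0" using smult[of 0 0 h] by simp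
    thus ?thesis by (induction A rule: infinite_finite_induct) (auto simp: add)
  qed
  have "\<exists>p. (\<forall>k. degree (p k) = k \<and> lead_coeff (p k) = 1) \<and> (\<forall>j<n. \<forall>k<n. j \<noteq> k \<longrightarrow> ip (p j) (p k) = 0)"
    if "n \<le> N" for n
    using that
  proof (induction n)
    case 0
    show ?case by (intro exI[of _ "\<lambda>k. monom 1 k"]) (auto simp: degree_monom_eq)
  next
    case (Suc n)
    then obtain p where p: "\<And>k. degree (p k) = k" "\<And>k. lead_coeff (p k) = 1"
      and orth: "\<And>j k. j < n \<Longrightarrow> k < n \<Longrightarrow> j \<noteq> k \<Longrightarrow> ip (p j) (p k) = 0"
      by (metis Suc_leD)
    have p_pos: "ip (p j) (p j) > 0" if "j < n" for j
      using pos[of "p j"] p[of j] that Suc.prems by force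
    define proj where "proj = (\<Sum>j<n. Polynomial.smult (ip (monom 1 n) (p j) / ip (p j) (p j)) (p j))"
    define r where "r = monom 1 n - proj"
    have cproj: "coeff proj k = 0" if "k \<ge> n" for k
      unfolding proj_def coeff_sum using that by (auto intro!: sum.neutral coeff_eq_0 simp: p)
    have cn: "coeff r n = 1" by (simp add: r_def cproj)
    have "degree r \<le> n" by (rule degree_le) (auto simp: r_def cproj)
    hence deg_r: "degree r = n" using cn le_degree[of r n] by force
    have r_orth: "ip r (p k) = 0" if k: "k < n" for k
    proof -
      have "r = monom 1 n + Polynomial.smult (-1) proj" by (simp add: r_def)
      hence "ip r (p k) = ip (monom 1 n) (p k) - ip proj (p k)"
        by (simp only: add smult)
      also have "ip proj (p k) = (\<Sum>j<n. if j = k then ip (monom 1 n) (p k) else 0)"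
        unfolding proj_def sum smult using k orth p_pos[OF k] by (intro sum.cong refl) auto
      finally show ?thesis using k by simp
    qed
    have "(\<forall>k. degree ((p(n := r)) k) = k \<and> lead_coeff ((p(n := r)) k) = 1) \<and>
       (\<forall>j<Suc n. \<forall>k<Suc n. j \<noteq> k \<longrightarrow> ip ((p(n := r)) j) ((p(n := r)) k) = 0)"
      using p deg_r cn orth r_orth sym[of _ r] by (auto simp: less_Suc_eq)
    thus ?case by blast
  qed
  from this[OF order_refl] show ?thesis .
qed

section \<open>Integer polynomials in a box\<close>

lemma monic_combination_eq_0:
  fixes p :: "nat \<Rightarrow> real poly"
  assumes p: "\<And>k. degree (p k) = k" "\<And>k. lead_coeff (p k) = 1"
    and zero: "(\<Sum>k<N. Polynomial.smult (c k) (p k)) = 0" and "k < N"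
  shows "c k = 0"
  using zero \<open>k < N\<close>
proof (induction N arbitrary: k)
  case (Suc N)
  have "coeff (\<Sum>k<Suc N. Polynomial.smult (c k) (p k)) N = (\<Sum>k<Suc N. if k = N then c N else 0)"
    unfolding coeff_sum using p(2)[of N] by (intro sum.cong refl) (auto simp: p coeff_eq_0)
  hence "c N = 0" by (simp only: Suc.prems(1) coeff_0 sum.delta finite_lessThan lessThan_iff lessI if_True)
  with Suc show ?case by (cases "k = N") auto
qed simp

definition int_coeffs :: "real poly \<Rightarrow> bool" where
  "int_coeffs q \<longleftrightarrow> (\<forall>k. coeff q k \<in> \<int>)"

lemma card_integers_shifted_interval:
  fixes r :: real
  shows "card {x. 0 \<le> x \<and> x < real L \<and> r + x \<in> \<int>} = L" "finite {x. 0 \<le> x \<and> x < real L \<and> r + x \<in> \<int>}"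
proof -
  let ?f = "\<lambda>i. of_int (\<lceil>r\<rceil> + int i) - r"
  have "{x. 0 \<le> x \<and> x < real L \<and> r + x \<in> \<int>} = ?f ` {..<L}"
  proof (intro equalityI subsetI)
    fix x assume "x \<in> {x. 0 \<le> x \<and> x < real L \<and> r + x \<in> \<int>}"
    then obtain m where x: "0 \<le> x" "x < real L" and m: "r + x = of_int m" by (auto elim: Ints_cases)
    have "\<lceil>r\<rceil> \<le> m" using x m by (simp add: ceiling_le_iff)
    moreover have "m < \<lceil>r\<rceil> + int L" using x m by linarith
    ultimately show "x \<in> ?f ` {..<L}" using m
      by (intro image_eqI[of _ _ "nat (m - \<lceil>r\<rceil>)"]) auto
  next
    fix x assume "x \<in> ?f ` {..<L}"
    then obtain i where i: "i < L" "x = ?f i" by auto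
    have "real i + 1 \<le> real L" using i by linarith
    hence "x < real L" using i by linarith
    moreover have "0 \<le> x" using i by linarith
    ultimately show "x \<in> {x. 0 \<le> x \<and> x < real L \<and> r + x \<in> \<int>}" using i by simp
  qed
  moreover have "inj_on ?f {..<L}" by (auto simp: inj_on_def)
  ultimately show "card {x. 0 \<le> x \<and> x < real L \<and> r + x \<in> \<int>} = L" "finite {x. 0 \<le> x \<and> x < real L \<and> r + x \<in> \<int>}"
    by (auto simp: card_image)
qed

text \<open>
  Because the \<open>p k\<close> are monic with increasing degrees, the integrality conditions can be met one
  coefficient after the other, starting at the top: once the higher coordinates are fixed,
  coordinate \<open>k\<close> has to lie in a translate of the integers, which has exactly \<open>L\<close> elements in a
  half-open interval of length \<open>L\<close>. The polynomial \<open>r\<close> carries the contribution of the coordinates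
  that are already fixed.
\<close>

lemma card_integer_polys_in_cube:
  fixes p :: "nat \<Rightarrow> real poly" and L :: nat
  assumes p: "\<And>k. degree (p k) = k" "\<And>k. lead_coeff (p k) = 1"
    and r: "\<And>k. k \<ge> N \<Longrightarrow> coeff r k = 0"
  shows "\<exists>C. finite C \<and> card C = L ^ N \<and> C \<subseteq> {..<N} \<rightarrow>\<^sub>E {0..<real L} \<and>
           (\<forall>c\<in>C. int_coeffs (r + (\<Sum>k<N. Polynomial.smult (c k) (p k))))"
  using r
proof (induction N arbitrary: r)
  case 0
  hence "r = 0" by (auto simp: poly_eq_iff)
  thus ?case by (intro exI[of _ "{\<lambda>_. undefined}"]) (auto simp: int_coeffs_def)
next
  case (Suc N)
  define X where "X = {x. 0 \<le> x \<and> x < real L \<and> coeff r N + x \<in> \<int>}"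
  have X: "finite X" "card X = L" using card_integers_shifted_interval by (auto simp: X_def)
  define r' where "r' x = r + Polynomial.smult x (p N) - monom (coeff r N + x) N" for x
  have "coeff (r' x) k = 0" if "k \<ge> N" for x k
    using that Suc.prems[of k] p(2)[of N] by (cases "k = N") (auto simp: r'_def p coeff_eq_0)
  hence "\<forall>x. \<exists>C. finite C \<and> card C = L ^ N \<and> C \<subseteq> {..<N} \<rightarrow>\<^sub>E {0..<real L} \<and>
           (\<forall>c\<in>C. int_coeffs (r' x + (\<Sum>k<N. Polynomial.smult (c k) (p k))))"
    using Suc.IH by blast
  then obtain C where C: "\<And>x. finite (C x)" "\<And>x. card (C x) = L ^ N" "\<And>x. C x \<subseteq> {..<N} \<rightarrow>\<^sub>E {0..<real L}"
    "\<And>x c. c \<in> C x \<Longrightarrow> int_coeffs (r' x + (\<Sum>k<N. Polynomial.smult (c k) (p k)))"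
    by metis
  define D where "D = (\<lambda>(x, c). c(N := x)) ` (Sigma X C)"
  have inj: "inj_on (\<lambda>(x, c). c(N := x)) (Sigma X C)"
  proof (rule inj_onI, clarify)
    fix x c x' c' assume h: "c \<in> C x" "c' \<in> C x'" "c(N := x) = c'(N := x')"
    have "x = x'" using fun_cong[OF h(3), of N] by simp
    moreover have "c k = c' k" for k
    proof (cases "k = N")
      case True
      have "c N = undefined" and "c' N = undefined" using h(1,2) C(3) by (blast intro: PiE_arb)+
      thus ?thesis using True by simp
    qed (use fun_cong[OF h(3), of k] in auto)
    ultimately show "x = x' \<and> c = c'" by auto
  qed
  have "finite D" using X C by (auto simp: D_def)
  moreover have "card D = L ^ Suc N"
    unfolding D_def using X C by (simp add: card_image[OF inj])
  moreover have "D \<subseteq> {..<Suc N} \<rightarrow>\<^sub>E {0..<real L}"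
  proof
    fix d assume "d \<in> D"
    then obtain x c where xc: "x \<in> X" "c \<in> C x" "d = c(N := x)" by (auto simp: D_def)
    have "c \<in> {..<N} \<rightarrow>\<^sub>E {0..<real L}" using C(3) xc(2) by blast
    moreover have "x \<in> {0..<real L}" using xc(1) by (simp add: X_def)
    ultimately show "d \<in> {..<Suc N} \<rightarrow>\<^sub>E {0..<real L}"
      unfolding xc(3) lessThan_Suc by (intro PiE_fun_upd)
  qed
  moreover have "int_coeffs (r + (\<Sum>k<Suc N. Polynomial.smult (d k) (p k)))" if "d \<in> D" for d
  proof -
    from that obtain x c where xc: "x \<in> X" "c \<in> C x" "d = c(N := x)" by (auto simp: D_def)
    have "(\<Sum>k<N. Polynomial.smult (d k) (p k)) = (\<Sum>k<N. Polynomial.smult (c k) (p k))"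
      using xc(3) by (intro sum.cong) auto
    hence "r + (\<Sum>k<Suc N. Polynomial.smult (d k) (p k)) =
        (r' x + (\<Sum>k<N. Polynomial.smult (c k) (p k))) + monom (coeff r N + x) N"
      using xc(3) by (simp add: r'_def)
    thus ?thesis using C(4)[OF xc(2)] xc(1) by (auto simp: int_coeffs_def X_def)
  qed
  ultimately show ?case by blast
qed

text \<open>
  A discrete form of Blichfeldt's argument. The cube of side \<open>L\<close> contains \<open>L^N\<close> integer polynomials
  and is covered by about \<open>L^N / (\<Prod>k. s k)\<close> boxes of sides \<open>s k\<close>, so for large \<open>L\<close> one of the
  boxes contains at least \<open>T\<close> of them; subtracting one of these moves the box to the origin.
\<close>

lemma many_integer_polys_in_box:
  fixes p :: "nat \<Rightarrow> real poly" and s :: "nat \<Rightarrow> real" and T :: real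
  assumes p: "\<And>k. degree (p k) = k" "\<And>k. lead_coeff (p k) = 1"
    and s: "\<And>k. k < N \<Longrightarrow> s k > 0" and T: "T < (\<Prod>k<N. s k)"
  shows "\<exists>A. finite A \<and> T \<le> real (card A) \<and> (\<forall>q\<in>A. int_coeffs q \<and>
           (\<exists>c. q = (\<Sum>k<N. Polynomial.smult (c k) (p k)) \<and> (\<forall>k<N. \<bar>c k\<bar> \<le> s k)))"
proof -
  have "(\<lambda>L. T * (\<Prod>k<N. 1 / s k + 1 / real L)) \<longlonglongrightarrow> T * (\<Prod>k<N. 1 / s k + 0)"
    by (intro tendsto_intros lim_1_over_n)
  moreover have "T * (\<Prod>k<N. 1 / s k + 0) < 1"
  proof -
    have pp: "(\<Prod>k<N. s k) > 0" using s by (intro prod_pos) auto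
    have "(\<Prod>k<N. 1 / s k + 0) = 1 / (\<Prod>k<N. s k)" by (simp add: prod_dividef)
    thus ?thesis using T pp by (simp add: field_simps)
  qed
  ultimately have "eventually (\<lambda>L. T * (\<Prod>k<N. 1 / s k + 1 / real L) < 1) sequentially"
    by (rule order_tendstoD)
  hence "eventually (\<lambda>L. T * (\<Prod>k<N. 1 / s k + 1 / real L) < 1 \<and> L > 0) sequentially"
    using eventually_gt_at_top[of 0] by eventually_elim auto
  then obtain L :: nat where L: "T * (\<Prod>k<N. 1 / s k + 1 / real L) < 1" "L > 0"
    by (metis (no_types, lifting) eventually_happens trivial_limit_sequentially)
  define Q where "Q c = (\<Sum>k<N. Polynomial.smult (c k) (p k))" for c
  obtain C where C: "finite C" "card C = L ^ N" "C \<subseteq> {..<N} \<rightarrow>\<^sub>E {0..<real L}" "\<And>c. c \<in> C \<Longrightarrow> int_coeffs (Q c)"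
    using card_integer_polys_in_cube[OF p, of N 0 L] by (auto simp: Q_def)
  define cell where "cell c = (\<lambda>k\<in>{..<N}. \<lfloor>c k / s k\<rfloor>)" for c
  define B where "B = PiE {..<N} (\<lambda>k. {0..\<lfloor>real L / s k\<rfloor>})"
  have "cell \<in> C \<rightarrow> B"
  proof
    fix c assume "c \<in> C"
    hence c: "0 \<le> c k" "c k < real L" if "k < N" for k using C(3) that by (auto simp: PiE_def Pi_def)
    show "cell c \<in> B" unfolding cell_def B_def
      using c s by (auto simp: less_imp_le intro!: floor_mono divide_right_mono)
  qed
  moreover have finB: "finite B" by (auto simp: B_def intro!: finite_PiE)
  moreover have "B \<noteq> {}" using s by (auto simp: B_def PiE_eq_empty_iff not_less less_imp_le)
  ultimately obtain y where y: "card (cell -` {y} \<inter> C) * card B \<ge> card C"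
    using pigeonhole_card[of cell C B] C(1) by blast
  define F where "F = cell -` {y} \<inter> C"
  have finF: "finite F" using C(1) by (simp add: F_def)
  have cardB: "real (card B) \<le> real L ^ N * (\<Prod>k<N. 1 / s k + 1 / real L)"
  proof -
    have "real (card B) = (\<Prod>k<N. real (nat (\<lfloor>real L / s k\<rfloor> + 1)))"
      by (simp add: B_def card_PiE)
    also have "\<dots> \<le> (\<Prod>k<N. real L * (1 / s k + 1 / real L))"
    proof (intro prod_mono conjI)
      fix k assume "k \<in> {..<N}"
      hence "s k > 0" using s by auto
      hence "0 \<le> \<lfloor>real L / s k\<rfloor>" by (simp add: less_imp_le)
      hence "real (nat (\<lfloor>real L / s k\<rfloor> + 1)) = of_int \<lfloor>real L / s k\<rfloor> + 1" by simp
      also have "\<dots> \<le> real L / s k + 1" by simp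
      finally show "real (nat (\<lfloor>real L / s k\<rfloor> + 1)) \<le> real L * (1 / s k + 1 / real L)"
        using L by (simp add: distrib_left)
    qed auto
    finally show ?thesis by (simp add: prod.distrib)
  qed
  have T_le: "T \<le> real (card F)"
  proof (cases "T \<le> 0")
    case False
    have nn: "0 \<le> (\<Prod>k<N. 1 / s k + 1 / real L)" using s by (intro prod_nonneg) (auto intro!: add_nonneg_nonneg simp: less_imp_le)
    have "real L ^ N \<le> real (card F) * real (card B)"
      using y C(2) unfolding F_def by (metis of_nat_le_iff of_nat_mult of_nat_power)
    also have "\<dots> \<le> real (card F) * (real L ^ N * (\<Prod>k<N. 1 / s k + 1 / real L))"
      by (intro mult_left_mono cardB) auto
    finally have "real L ^ N * 1 \<le> real L ^ N * (real (card F) * (\<Prod>k<N. 1 / s k + 1 / real L))"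
      by (simp add: mult_ac)
    hence "1 \<le> real (card F) * (\<Prod>k<N. 1 / s k + 1 / real L)" using L(2) by simp
    hence "T * (\<Prod>k<N. 1 / s k + 1 / real L) \<le> real (card F) * (\<Prod>k<N. 1 / s k + 1 / real L)"
      using L(1) by linarith
    moreover have "(\<Prod>k<N. 1 / s k + 1 / real L) > 0"
      using \<open>1 \<le> real (card F) * (\<Prod>k<N. 1 / s k + 1 / real L)\<close> nn by (metis less_eq_real_def mult_zero_right not_one_le_zero)
    ultimately show ?thesis by simp
  qed simp
  show ?thesis
  proof (cases "F = {}")
    case True
    thus ?thesis using T_le by (intro exI[of _ "{}"]) auto
  next
    case False
    then obtain c0 where c0: "c0 \<in> F" by blast
    have diff: "Q c - Q c0 = Q (\<lambda>k. c k - c0 k)" for c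
      by (simp add: Q_def smult_diff_left sum_subtractf)
    define A where "A = (\<lambda>c. Q c - Q c0) ` F"
    have "inj_on (\<lambda>c. Q c - Q c0) F"
    proof (rule inj_onI)
      fix c c' assume h: "c \<in> F" "c' \<in> F" "Q c - Q c0 = Q c' - Q c0"
      hence "(\<Sum>k<N. Polynomial.smult (c k - c' k) (p k)) = 0"
        by (simp add: Q_def smult_diff_left sum_subtractf)
      hence "c k = c' k" if "k < N" for k
        using monic_combination_eq_0[OF p _ that, of "\<lambda>k. c k - c' k"] by simp
      moreover have "c \<in> extensional {..<N}" "c' \<in> extensional {..<N}"
        using h(1,2) C(3) by (auto simp: F_def PiE_def)
      ultimately show "c = c'" by (intro extensionalityI) auto
    qed
    hence "card A = card F" by (simp add: A_def card_image)
    moreover have "int_coeffs q \<and> (\<exists>c. q = (\<Sum>k<N. Polynomial.smult (c k) (p k)) \<and> (\<forall>k<N. \<bar>c k\<bar> \<le> s k))"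
      if "q \<in> A" for q
    proof -
      from that obtain c where c: "c \<in> F" "q = Q c - Q c0" by (auto simp: A_def)
      have "int_coeffs q" using c c0 C(4) by (auto simp: F_def int_coeffs_def)
      moreover have "\<bar>c k - c0 k\<bar> \<le> s k" if k: "k < N" for k
      proof -
        have "cell c k = cell c0 k" using c(1) c0 by (auto simp: F_def)
        hence "\<lfloor>c k / s k\<rfloor> = \<lfloor>c0 k / s k\<rfloor>" using k by (simp add: cell_def)
        hence "\<bar>c k / s k - c0 k / s k\<bar> \<le> 1" by linarith
        hence "\<bar>c k - c0 k\<bar> / s k \<le> 1" using s[OF k] by (simp add: diff_divide_distrib[symmetric] abs_div)
        thus ?thesis using s[OF k] by (simp add: field_simps)
      qed
      ultimately show ?thesis using c(2) diff[of c] by (auto simp: Q_def)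
    qed
    ultimately show ?thesis using T_le finF by (intro exI[of _ A]) (auto simp: A_def)
  qed
qed

section \<open>Polynomial sequences in the binomial basis\<close>

definition newton :: "(nat \<Rightarrow> real) \<Rightarrow> nat \<Rightarrow> nat \<Rightarrow> real" where
  "newton d N m = (\<Sum>k<N. d k * real (m choose k))"

text \<open>
  The generating function of the sequence \<open>newton d N\<close>, summed in closed form.
\<close>

definition newton_gf :: "(nat \<Rightarrow> real) \<Rightarrow> nat \<Rightarrow> complex \<Rightarrow> complex" where
  "newton_gf d N y = (\<Sum>k<N. of_real (d k) * (y ^ k / (1 - y) ^ Suc k))"

definition circle_mean :: "(nat \<Rightarrow> real) \<Rightarrow> nat \<Rightarrow> nat \<Rightarrow> real \<Rightarrow> real" where
  "circle_mean d N M r =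
     1 / real M * (\<Sum>j<M. (cmod (newton_gf d N (cis (2 * pi * real j / real M) / of_real r)))\<^sup>2)"

text \<open>
  The coefficients are iterated differences at \<open>0\<close>, and passing from a sequence to its difference
  sequence multiplies a bound \<open>X * \<rho>^m\<close> by \<open>1 + \<rho>\<close>.
\<close>

lemma newton_coeff_bound:
  fixes \<rho> :: real
  assumes "\<rho> \<ge> 0" "\<And>m. m < N \<Longrightarrow> \<bar>newton d N m\<bar> \<le> X * \<rho> ^ m" "k < N"
  shows "\<bar>d k\<bar> \<le> X * (1 + \<rho>) ^ k"
  using assms(2,3)
proof (induction N arbitrary: d X k)
  case (Suc N)
  have zero: "newton d (Suc N) 0 = d 0"
  proof -
    have "newton d (Suc N) 0 = (\<Sum>k<Suc N. if k = 0 then d 0 else 0)"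
      unfolding newton_def by (intro sum.cong refl) auto
    thus ?thesis by simp
  qed
  show ?case
  proof (cases k)
    case 0
    thus ?thesis using Suc.prems(1)[of 0] zero by simp
  next
    case (Suc k')
    have shift: "newton (\<lambda>k. d (Suc k)) N m = newton d (Suc N) (Suc m) - newton d (Suc N) m" for m
      unfolding newton_def sum_subtractf[symmetric]
      by (subst sum.lessThan_Suc_shift) (simp add: algebra_simps)
    have "\<bar>newton (\<lambda>k. d (Suc k)) N m\<bar> \<le> (X * (1 + \<rho>)) * \<rho> ^ m" if "m < N" for m
    proof -
      have "\<bar>newton (\<lambda>k. d (Suc k)) N m\<bar> \<le> \<bar>newton d (Suc N) (Suc m)\<bar> + \<bar>newton d (Suc N) m\<bar>"
        unfolding shift by simp
      also have "\<dots> \<le> X * \<rho> ^ Suc m + X * \<rho> ^ m"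
        using that by (intro add_mono Suc.prems(1)) auto
      finally show ?thesis by (simp add: algebra_simps)
    qed
    from Suc.IH[OF this, of k'] Suc Suc.prems(2) show ?thesis by (simp add: mult.assoc)
  qed
qed simp

text \<open>
  The values below \<open>N\<close> determine the polynomial. Inserting \<open>s^k / s^N \<ge> 1\<close> into the terms of
  the binomial expansion lets it be summed by the binomial theorem; the base of the resulting
  exponential can be brought below any number greater than 1 by a small choice of \<open>s\<close>.
\<close>

lemma newton_growth:
  fixes \<rho> s :: real
  assumes \<rho>: "\<rho> \<ge> 0" and s: "0 < s" "s \<le> 1" and X: "X \<ge> 0"
    and bound: "\<And>m. m < N \<Longrightarrow> \<bar>newton d N m\<bar> \<le> X * \<rho> ^ m"
  shows "\<bar>newton d N m\<bar> \<le> X / s ^ N * (1 + s * (1 + \<rho>)) ^ m"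
proof -
  have "\<bar>newton d N m\<bar> \<le> (\<Sum>k<N. \<bar>d k * real (m choose k)\<bar>)" unfolding newton_def by (rule sum_abs)
  also have "\<dots> \<le> (\<Sum>k<N. X / s ^ N * (real (m choose k) * (s * (1 + \<rho>)) ^ k))"
  proof (intro sum_mono)
    fix k assume k: "k \<in> {..<N}"
    have "s ^ N \<le> s ^ k" using s k by (intro power_decreasing) auto
    hence one: "1 \<le> s ^ k / s ^ N" using s by simp
    have "\<bar>d k * real (m choose k)\<bar> \<le> (X * (1 + \<rho>) ^ k) * real (m choose k)"
      unfolding abs_mult using newton_coeff_bound[OF \<rho> bound, of k] k X \<rho>
      by (intro mult_mono mult_nonneg_nonneg zero_le_power) auto
    also have "\<dots> = (X * (1 + \<rho>) ^ k * real (m choose k)) * 1" by simp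
    also have "\<dots> \<le> (X * (1 + \<rho>) ^ k * real (m choose k)) * (s ^ k / s ^ N)"
      using one X \<rho> by (intro mult_left_mono mult_nonneg_nonneg) auto
    also have "\<dots> = X / s ^ N * (real (m choose k) * (s * (1 + \<rho>)) ^ k)"
      unfolding power_mult_distrib by (simp add: mult_ac)
    finally show "\<bar>d k * real (m choose k)\<bar> \<le> X / s ^ N * (real (m choose k) * (s * (1 + \<rho>)) ^ k)" .
  qed
  also have "\<dots> \<le> (\<Sum>k\<in>{..<N} \<union> {..m}. X / s ^ N * (real (m choose k) * (s * (1 + \<rho>)) ^ k))"
    using X s \<rho> by (intro sum_mono2) auto
  also have "\<dots> = (\<Sum>k\<le>m. X / s ^ N * (real (m choose k) * (s * (1 + \<rho>)) ^ k))"
    by (intro sum.mono_neutral_right) (auto simp: binomial_eq_0)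
  also have "\<dots> = X / s ^ N * (\<Sum>k\<le>m. real (m choose k) * (s * (1 + \<rho>)) ^ k)"
    by (simp add: sum_distrib_left)
  also have "(\<Sum>k\<le>m. real (m choose k) * (s * (1 + \<rho>)) ^ k) = (1 + s * (1 + \<rho>)) ^ m"
    using binomial_ring[of "s * (1 + \<rho>)" 1 m] by (simp add: add.commute)
  finally show ?thesis .
qed

lemma binomial_column_gf:
  fixes y :: complex
  assumes y: "cmod y < 1"
  shows "(\<lambda>m. of_nat (m choose k) * y ^ m) sums (y ^ k / (1 - y) ^ Suc k)"
proof -
  have ny: "1 - y \<noteq> 0" using y by auto
  have "(\<lambda>n. (- of_nat (Suc k) gchoose n) * (- y) ^ n) sums (1 + - y) powr (- of_nat (Suc k))"
    by (rule gen_binomial_complex) (use y in simp)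
  moreover have "(- of_nat (Suc k) gchoose n) * (- y) ^ n = of_nat ((n + k) choose k) * y ^ n" for n
  proof -
    have "(- of_nat (Suc k) gchoose n :: complex) = (-1) ^ n * (of_nat (n + k) gchoose n)"
      by (subst gbinomial_minus) (simp add: add_ac)
    also have "(of_nat (n + k) gchoose n :: complex) = of_nat ((n + k) choose k)"
      using binomial_symmetric[of k "n + k"] by (simp add: binomial_gbinomial)
    finally have "(- of_nat (Suc k) gchoose n) * (- y) ^ n
        = ((-1) ^ n * (-1) ^ n) * (of_nat ((n + k) choose k) * y ^ n)"
      by (simp only: power_minus[of y] mult_ac)
    also have "(-1) ^ n * (-1) ^ n = (1 :: complex)" by (simp flip: power_mult_distrib)
    finally show ?thesis by simp
  qed
  moreover have "(1 + - y) powr (- of_nat (Suc k)) = 1 / (1 - y) ^ Suc k"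
    using ny by (subst powr_minus, subst powr_nat') (auto simp: inverse_eq_divide)
  ultimately have "(\<lambda>n. of_nat ((n + k) choose k) * y ^ n) sums (1 / (1 - y) ^ Suc k)"
    by simp
  from sums_mult[OF this, of "y ^ k"]
  have "(\<lambda>n. of_nat ((n + k) choose k) * y ^ (n + k)) sums (y ^ k / (1 - y) ^ Suc k)"
    by (simp add: power_add mult_ac)
  hence "(\<lambda>m. of_nat (m choose k) * y ^ m) sums (y ^ k / (1 - y) ^ Suc k + (\<Sum>m<k. of_nat (m choose k) * y ^ m))"
    by (subst (asm) sums_iff_shift)
  moreover have "(\<Sum>m<k. of_nat (m choose k) * y ^ m) = 0"
    by (intro sum.neutral) auto
  ultimately show ?thesis by simp
qed

lemma newton_gf_sums:
  assumes "cmod y < 1"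
  shows "(\<lambda>m. of_real (newton d N m) * y ^ m) sums newton_gf d N y"
proof -
  have "(\<lambda>m. \<Sum>k<N. of_real (d k) * (of_nat (m choose k) * y ^ m)) sums newton_gf d N y"
    unfolding newton_gf_def by (intro sums_sum sums_mult binomial_column_gf assms)
  moreover have "of_real (newton d N m) * y ^ m = (\<Sum>k<N. of_real (d k) * (of_nat (m choose k) * y ^ m))" for m
    by (simp add: newton_def sum_distrib_right mult.assoc)
  ultimately show ?thesis by simp
qed

lemma sum_roots_of_unity_power:
  assumes "M > 0" "m < M" "n < M"
  shows "(\<Sum>j<M. cis (2 * pi * real j / real M) ^ m * cnj (cis (2 * pi * real j / real M) ^ n)) = (if m = n then of_nat M else 0)"
proof -
  define u where "u = cis (2 * pi * (real m - real n) / M)"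
  have trm: "cis (2 * pi * real j / real M) ^ m * cnj (cis (2 * pi * real j / real M) ^ n) = u ^ j" for j :: nat
  proof -
    have "cis (2 * pi * real j / real M) ^ m * cnj (cis (2 * pi * real j / real M) ^ n)
        = cis (real m * (2 * pi * real j / real M) + - (real n * (2 * pi * real j / real M)))"
      by (simp only: Complex.DeMoivre cis_cnj cis_mult)
    also have "real m * (2 * pi * real j / real M) + - (real n * (2 * pi * real j / real M)) = real j * (2 * pi * (real m - real n) / M)"
      by (simp add: diff_divide_distrib right_diff_distrib mult_ac)
    finally show ?thesis by (simp add: u_def Complex.DeMoivre)
  qed
  show ?thesis
  proof (cases "m = n")
    case True
    thus ?thesis unfolding trm by (simp add: u_def)
  next
    case False
    have uM: "u ^ M = 1"
    proof -
      have "real M * (2 * pi * (real m - real n) / M) = 2 * pi * of_int (int m - int n)" using assms by simp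
      thus ?thesis by (simp only: u_def Complex.DeMoivre cis_multiple_2pi Ints_of_int)
    qed
    have "u \<noteq> 1"
    proof
      assume "u = 1"
      hence "cos (2 * pi * (real m - real n) / M) = 1" unfolding u_def by (metis cis.sel(1) one_complex.sel(1))
      then obtain i :: int where "2 * pi * (real m - real n) / M = of_int i * 2 * pi"
        using cos_one_2pi_int by blast
      hence "(2 * pi) * ((real m - real n) / M) = (2 * pi) * of_int i" by (simp only: mult_ac times_divide_eq_right)
      hence "(real m - real n) / M = of_int i" by (subst (asm) mult_cancel_left) simp
      hence "real m - real n = of_int i * real M" using assms by (simp add: field_simps)
      hence "int m - int n = i * int M" by (metis of_int_diff of_int_eq_iff of_int_mult of_int_of_nat_eq)
      hence "int M dvd int m - int n" by simp
      moreover have "\<bar>int m - int n\<bar> < int M" using assms by linarith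
      ultimately have "int m - int n = 0" using dvd_imp_le_int[of "int m - int n" "int M"] by linarith
      thus False using False by simp
    qed
    thus ?thesis unfolding trm using False uM by (simp add: geometric_sum)
  qed
qed

lemma parseval_roots_of_unity:
  fixes a :: "nat \<Rightarrow> real"
  assumes "M > 0"
  shows "(\<Sum>j<M. (cmod (\<Sum>m<M. of_real (a m) * cis (2 * pi * real j / real M) ^ m))\<^sup>2) = real M * (\<Sum>m<M. (a m)\<^sup>2)"
proof -
  let ?z = "\<lambda>j. cis (2 * pi * real j / real M)"
  have "complex_of_real (\<Sum>j<M. (cmod (\<Sum>m<M. of_real (a m) * ?z j ^ m))\<^sup>2)
     = (\<Sum>j<M. \<Sum>m<M. \<Sum>n<M. of_real (a m) * of_real (a n) * (?z j ^ m * cnj (?z j ^ n)))"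
    unfolding of_real_sum complex_norm_square by (simp add: sum_product mult_ac)
  also have "\<dots> = (\<Sum>m<M. \<Sum>n<M. of_real (a m) * of_real (a n) * (\<Sum>j<M. ?z j ^ m * cnj (?z j ^ n)))"
    unfolding sum_distrib_left by (subst sum.swap) (intro sum.cong refl sum.swap)
  also have "\<dots> = (\<Sum>m<M. \<Sum>n<M. if n = m then of_real (a m) * of_real (a m) * of_nat M else 0)"
    using sum_roots_of_unity_power[OF assms] by (intro sum.cong refl) auto
  also have "\<dots> = complex_of_real (real M * (\<Sum>m<M. (a m)\<^sup>2))"
    by (simp add: power2_eq_square sum_distrib_left mult_ac)
  finally show ?thesis by (simp only: of_real_eq_iff)
qed

text \<open>
  With \<open>s\<close> chosen such that the growth base is \<open>sqrt \<rho>\<close>, the weighted values \<open>a m\<close>, that is,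
  \<open>newton d N m / \<rho>^m\<close>, are at most \<open>s^(-N) * \<sigma>^m\<close> times the maximum over \<open>m < N\<close>, where
  \<open>\<sigma> = 1 / sqrt \<rho>\<close>. Beyond \<open>K * N\<close> this is negligible. Hence bounds on the first \<open>M\<close> values
  extend to all values, and truncating the generating function at \<open>M\<close> changes it by at most half
  of the \<open>l\<^sup>2\<close>-norm of the retained values, which are the Fourier coefficients of the truncation
  on the \<open>M\<close>-th roots of unity.
\<close>

lemma newton_sequence_control:
  fixes \<rho> :: real
  assumes \<rho>: "\<rho> > 1"
  obtains K where "K \<ge> 1"
    and "\<forall>N>0. \<forall>M\<ge>K * N. \<forall>d. (\<Sum>m<M. (newton d N m / \<rho> ^ m)\<^sup>2) \<le> 4 * circle_mean d N M \<rho>"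
    and "\<forall>N>0. \<forall>M\<ge>K * N. \<forall>d t. (\<forall>m<M. \<bar>newton d N m\<bar> \<le> t * \<rho> ^ m) \<longrightarrow>
           (\<forall>m. \<bar>newton d N m\<bar> \<le> t * \<rho> ^ m)"
proof -
  define \<sigma> where "\<sigma> = 1 / sqrt \<rho>"
  have \<sigma>: "0 < \<sigma>" "\<sigma> < 1" using \<rho> by (auto simp: \<sigma>_def)
  define s where "s = (sqrt \<rho> - 1) / (1 + \<rho>)"
  have sq: "1 < sqrt \<rho>" "sqrt \<rho> \<le> \<rho>" using \<rho> by (auto simp: real_sqrt_le_iff' power2_eq_square)
  have s: "0 < s" "s \<le> 1" "1 + s * (1 + \<rho>) = sqrt \<rho>" using \<rho> sq by (auto simp: s_def field_simps)
  obtain K0 where K0: "\<sigma> ^ K0 < s * (1 - \<sigma>) / 2"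
    using real_arch_pow_inv[of "s * (1 - \<sigma>) / 2" \<sigma>] s \<sigma> by auto
  define K where "K = max 1 K0"
  have K: "K \<ge> 1" "\<sigma> ^ K \<le> s * (1 - \<sigma>) / 2"
  proof -
    show "K \<ge> 1" by (simp add: K_def)
    have "\<sigma> ^ K \<le> \<sigma> ^ K0" using \<sigma> by (intro power_decreasing) (auto simp: K_def)
    thus "\<sigma> ^ K \<le> s * (1 - \<sigma>) / 2" using K0 by simp
  qed
  have decay: "\<sigma> ^ M / s ^ N \<le> (1 - \<sigma>) / 2" if "N > 0" "M \<ge> K * N" for N M
  proof -
    have "\<sigma> ^ M \<le> \<sigma> ^ (K * N)" using that \<sigma> by (intro power_decreasing) auto
    also have "\<dots> = (\<sigma> ^ K) ^ N" by (simp add: power_mult)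
    also have "\<dots> \<le> (s * ((1 - \<sigma>) / 2)) ^ N" using K(2) \<sigma> by (intro power_mono) auto
    also have "\<dots> = s ^ N * ((1 - \<sigma>) / 2) ^ N" by (rule power_mult_distrib)
    also have "\<dots> \<le> s ^ N * ((1 - \<sigma>) / 2) ^ 1"
      using that \<sigma> s by (intro mult_left_mono power_decreasing) auto
    finally show ?thesis using s by (simp add: field_simps)
  qed
  have growth: "\<bar>newton d N m\<bar> / \<rho> ^ m \<le> X / s ^ N * \<sigma> ^ m"
    if X: "X \<ge> 0" and b: "\<And>m. m < N \<Longrightarrow> \<bar>newton d N m\<bar> \<le> X * \<rho> ^ m" for d N X m
  proof -
    have "\<rho> ^ m = sqrt \<rho> ^ m * sqrt \<rho> ^ m" using \<rho> by (simp flip: power_mult_distrib)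
    hence "sqrt \<rho> ^ m / \<rho> ^ m = \<sigma> ^ m" using \<rho> by (simp add: \<sigma>_def power_one_over)
    moreover have "\<bar>newton d N m\<bar> / \<rho> ^ m \<le> (X / s ^ N * sqrt \<rho> ^ m) / \<rho> ^ m"
      using newton_growth[OF _ s(1,2) X b, of m] \<rho> unfolding s(3) by (intro divide_right_mono) auto
    ultimately show ?thesis by (simp only: times_divide_eq_right[symmetric])
  qed
  have ext: "\<bar>newton d N m\<bar> \<le> t * \<rho> ^ m"
    if N: "N > 0" "M \<ge> K * N" and b: "\<And>m. m < M \<Longrightarrow> \<bar>newton d N m\<bar> \<le> t * \<rho> ^ m" for N M d t m
  proof (cases "m < M")
    case False
    have NM: "N \<le> M" using N K(1) by (metis le_trans mult_le_mono1 mult_1)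
    have t: "t \<ge> 0" using b[of 0] NM N(1) by simp
    have "\<bar>newton d N m\<bar> / \<rho> ^ m \<le> t / s ^ N * \<sigma> ^ m"
      using NM b t by (intro growth) auto
    also have "\<dots> = t * (\<sigma> ^ m / s ^ N)" by simp
    also have "\<dots> \<le> t * 1"
    proof (intro mult_left_mono t)
      have "\<sigma> ^ m / s ^ N \<le> \<sigma> ^ M / s ^ N" using False \<sigma> s by (intro divide_right_mono power_decreasing) auto
      also have "\<dots> \<le> (1 - \<sigma>) / 2" by (rule decay[OF N])
      also have "\<dots> \<le> 1" using \<sigma> by simp
      finally show "\<sigma> ^ m / s ^ N \<le> 1" .
    qed
    finally show ?thesis using \<rho> by (simp add: divide_le_eq)
  qed (use b in simp)
  have norm: "(\<Sum>m<M. (newton d N m / \<rho> ^ m)\<^sup>2) \<le> 4 * circle_mean d N M \<rho>"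
    if N: "N > 0" "M \<ge> K * N" for N M d
  proof -
    define a where "a m = newton d N m / \<rho> ^ m" for m
    define A where "A = sqrt (\<Sum>m<M. (a m)\<^sup>2)"
    have A2: "A\<^sup>2 = (\<Sum>m<M. (a m)\<^sup>2)" by (simp add: A_def sum_nonneg)
    have A0: "A \<ge> 0" by (simp add: A_def sum_nonneg)
    have NM: "N \<le> M" using N K(1) by (metis le_trans mult_le_mono1 mult_1)
    have M: "M > 0" using NM N by simp
    have aA: "\<bar>a m\<bar> \<le> A" if "m < M" for m
    proof -
      have "(a m)\<^sup>2 \<le> (\<Sum>m<M. (a m)\<^sup>2)" using that by (intro member_le_sum) auto
      thus ?thesis unfolding A_def by (rule real_le_rsqrt[of "\<bar>a m\<bar>", simplified])
    qed
    have b: "\<bar>newton d N m\<bar> \<le> A * \<rho> ^ m" if "m < N" for m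
      using aA[of m] that NM \<rho> by (simp add: a_def abs_div field_simps)
    have a_decay: "\<bar>a m\<bar> \<le> A / s ^ N * \<sigma> ^ m" for m
      using growth[OF A0 b, of m] \<rho> by (simp add: a_def abs_div)
    define z where "z j = cis (2 * pi * real j / real M)" for j
    define G where "G j = newton_gf d N (z j / of_real \<rho>)" for j
    define P where "P j = (\<Sum>m<M. of_real (a m) * z j ^ m)" for j
    have close: "cmod (G j - P j) \<le> A / 2" for j
    proof -
      have "cmod (z j / of_real \<rho>) < 1" using \<rho> by (simp add: z_def norm_divide)
      from newton_gf_sums[OF this, of d N]
      have "(\<lambda>m. of_real (newton d N m) * (z j / of_real \<rho>) ^ m) sums G j" by (simp add: G_def)
      moreover have "of_real (newton d N m) * (z j / of_real \<rho>) ^ m = of_real (a m) * z j ^ m" for m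
        by (simp add: a_def power_divide)
      ultimately have "(\<lambda>m. of_real (a m) * z j ^ m) sums G j" by simp
      hence "(\<lambda>m. of_real (a (m + M)) * z j ^ (m + M)) sums (G j - P j)"
        unfolding P_def by (subst sums_iff_shift) simp
      hence eq: "G j - P j = (\<Sum>m. of_real (a (m + M)) * z j ^ (m + M))" by (simp add: sums_iff)
      have gs: "(\<lambda>m. A / s ^ N * \<sigma> ^ M * \<sigma> ^ m) sums (A / s ^ N * \<sigma> ^ M * (1 / (1 - \<sigma>)))"
        using \<sigma> by (intro sums_mult geometric_sums) auto
      have "cmod (\<Sum>m. of_real (a (m + M)) * z j ^ (m + M)) \<le> (\<Sum>m. A / s ^ N * \<sigma> ^ M * \<sigma> ^ m)"
      proof (rule norm_suminf_le)
        fix m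
        have "cmod (of_real (a (m + M)) * z j ^ (m + M)) = \<bar>a (m + M)\<bar>"
          by (simp add: norm_mult norm_power z_def)
        also have "\<dots> \<le> A / s ^ N * \<sigma> ^ M * \<sigma> ^ m" using a_decay[of "m + M"] by (simp add: power_add mult_ac)
        finally show "cmod (of_real (a (m + M)) * z j ^ (m + M)) \<le> A / s ^ N * \<sigma> ^ M * \<sigma> ^ m" .
      next
        show "summable (\<lambda>m. A / s ^ N * \<sigma> ^ M * \<sigma> ^ m)" using gs by (rule sums_summable)
      qed
      also have "\<dots> = A * ((\<sigma> ^ M / s ^ N) / (1 - \<sigma>))" using gs by (simp add: sums_iff)
      also have "\<dots> \<le> A * (((1 - \<sigma>) / 2) / (1 - \<sigma>))"
        using \<sigma> by (intro mult_left_mono A0 divide_right_mono decay[OF N]) auto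
      also have "\<dots> = A / 2"
      proof -
        have half: "a * (x / 2 / x) = a / 2" if "x \<noteq> 0" for a x :: real using that by simp
        have "1 - \<sigma> \<noteq> 0" using \<sigma> by simp
        thus ?thesis by (rule half)
      qed
      finally show ?thesis unfolding eq .
    qed
    have step: "(cmod (P j))\<^sup>2 \<le> 2 * (cmod (G j))\<^sup>2 + A\<^sup>2 / 2" for j
    proof -
      have "cmod (P j) \<le> cmod (G j) + A / 2"
        using close[of j] norm_triangle_ineq2[of "P j" "G j"] by (simp add: norm_minus_commute)
      hence "(cmod (P j))\<^sup>2 \<le> (cmod (G j) + A / 2)\<^sup>2" by (intro power_mono) auto
      also have "\<dots> \<le> 2 * (cmod (G j))\<^sup>2 + 2 * (A / 2)\<^sup>2"
        using zero_le_power2[of "cmod (G j) - A / 2"] by (simp add: power2_eq_square algebra_simps)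
      finally show ?thesis by (simp add: power2_eq_square)
    qed
    have "real M * A\<^sup>2 = (\<Sum>j<M. (cmod (P j))\<^sup>2)"
      using parseval_roots_of_unity[OF M, of a] by (simp add: P_def z_def A2)
    also have "\<dots> \<le> (\<Sum>j<M. 2 * (cmod (G j))\<^sup>2 + A\<^sup>2 / 2)" by (intro sum_mono step)
    also have "\<dots> = 2 * (\<Sum>j<M. (cmod (G j))\<^sup>2) + real M * A\<^sup>2 / 2"
      by (simp add: sum.distrib sum_distrib_left)
    finally have "A\<^sup>2 \<le> 4 / real M * (\<Sum>j<M. (cmod (G j))\<^sup>2)" using M by (simp add: field_simps)
    thus ?thesis unfolding A2 by (simp add: a_def G_def z_def circle_mean_def)
  qed
  show ?thesis
  proof (rule that[OF K(1)])
    show "\<forall>N>0. \<forall>M\<ge>K * N. \<forall>d. (\<Sum>m<M. (newton d N m / \<rho> ^ m)\<^sup>2) \<le> 4 * circle_mean d N M \<rho>"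
      by (intro allI impI norm)
    show "\<forall>N>0. \<forall>M\<ge>K * N. \<forall>d t. (\<forall>m<M. \<bar>newton d N m\<bar> \<le> t * \<rho> ^ m) \<longrightarrow>
           (\<forall>m. \<bar>newton d N m\<bar> \<le> t * \<rho> ^ m)"
    proof (intro allI impI)
      fix N M :: nat and d t m
      assume N: "0 < N" "K * N \<le> M" and b: "\<forall>m<M. \<bar>newton d N m\<bar> \<le> t * \<rho> ^ m"
      show "\<bar>newton d N m\<bar> \<le> t * \<rho> ^ m"
        using ext[OF N] b by simp
    qed
  qed
qed

section \<open>Rounding many small values at once\<close>

lemma sum_half_powers_le_3: "(\<Sum>i\<in>{-int Y..int Y}. (1 / 2 :: real) ^ nat \<bar>i\<bar>) \<le> 3"
proof -
  have "(\<Sum>i\<in>{-int Y..int Y}. (1 / 2 :: real) ^ nat \<bar>i\<bar>) = 3 - 2 * (1 / 2) ^ Y"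
  proof (induction Y)
    case (Suc Y)
    have "{-int (Suc Y)..int (Suc Y)} = insert (- int (Suc Y)) (insert (int (Suc Y)) {-int Y..int Y})"
      by auto
    hence "(\<Sum>i\<in>{-int (Suc Y)..int (Suc Y)}. (1 / 2 :: real) ^ nat \<bar>i\<bar>)
        = (1 / 2) ^ Suc Y + ((1 / 2) ^ Suc Y + (\<Sum>i\<in>{-int Y..int Y}. (1 / 2 :: real) ^ nat \<bar>i\<bar>))"
      by (simp add: nat_add_distrib)
    thus ?case using Suc by simp
  qed simp
  thus ?thesis by simp
qed

text \<open>
  Weighting a vector by \<open>2^(Y - \<Sum>j. |n j|) \<ge> 1\<close> turns the count into a product of sums over single
  coordinates, each of which is at most 3.
\<close>

lemma card_small_integer_vectors:
  assumes J: "finite J"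
  shows "finite {n \<in> J \<rightarrow>\<^sub>E {-int Y..int Y}. (\<Sum>j\<in>J. \<bar>n j\<bar>) \<le> int Y}"
    and "card {n \<in> J \<rightarrow>\<^sub>E {-int Y..int Y}. (\<Sum>j\<in>J. \<bar>n j\<bar>) \<le> int Y} \<le> 2 ^ Y * 3 ^ card J"
proof -
  let ?P = "J \<rightarrow>\<^sub>E {-int Y..int Y}"
  let ?S = "{n \<in> ?P. (\<Sum>j\<in>J. \<bar>n j\<bar>) \<le> int Y}"
  have finP: "finite ?P" using J by (intro finite_PiE) auto
  show "finite ?S" using finP by (rule finite_subset[rotated]) auto
  have "real (card ?S) = (\<Sum>n\<in>?S. 1)" by simp
  also have "\<dots> \<le> (\<Sum>n\<in>?S. 2 ^ Y * (\<Prod>j\<in>J. (1 / 2) ^ nat \<bar>n j\<bar>))"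
  proof (intro sum_mono)
    fix n assume n: "n \<in> ?S"
    have "int (\<Sum>j\<in>J. nat \<bar>n j\<bar>) = (\<Sum>j\<in>J. \<bar>n j\<bar>)" by simp
    also have "\<dots> \<le> int Y" using n by simp
    finally have le: "(\<Sum>j\<in>J. nat \<bar>n j\<bar>) \<le> Y" by (simp only: of_nat_le_iff)
    have "(1::real) = 2 ^ Y * (1 / 2) ^ Y" by (simp flip: power_mult_distrib)
    also have "\<dots> \<le> 2 ^ Y * (1 / 2) ^ (\<Sum>j\<in>J. nat \<bar>n j\<bar>)"
      using le by (intro mult_left_mono power_decreasing) auto
    finally show "(1::real) \<le> 2 ^ Y * (\<Prod>j\<in>J. (1 / 2) ^ nat \<bar>n j\<bar>)" by (simp add: power_sum)
  qed
  also have "\<dots> \<le> (\<Sum>n\<in>?P. 2 ^ Y * (\<Prod>j\<in>J. (1 / 2) ^ nat \<bar>n j\<bar>))"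
    using finP by (intro sum_mono2) (auto intro!: mult_nonneg_nonneg prod_nonneg)
  also have "\<dots> = 2 ^ Y * (\<Prod>j\<in>J. \<Sum>i\<in>{-int Y..int Y}. (1 / 2) ^ nat \<bar>i\<bar>)"
    using J by (subst prod_sum_PiE) (auto simp: sum_distrib_left)
  also have "\<dots> \<le> 2 ^ Y * (\<Prod>j\<in>J. 3)"
    using sum_half_powers_le_3 by (intro mult_left_mono prod_mono) (auto intro!: sum_nonneg)
  also have "\<dots> = real (2 ^ Y * 3 ^ card J)" by simp
  finally show "card ?S \<le> 2 ^ Y * 3 ^ card J" by (simp only: of_nat_le_iff)
qed

lemma round_abs_le_square:
  fixes x :: real
  shows "real_of_int \<bar>round x\<bar> \<le> 4 * x\<^sup>2"
proof (cases "round x = 0")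
  case False
  define r where "r = real_of_int \<bar>round x\<bar>"
  have r1: "r \<ge> 1" using False by (simp add: r_def)
  have "\<bar>of_int (round x) - x\<bar> \<le> 1 / 2" by (rule of_int_round_abs_le)
  hence "r \<le> \<bar>x\<bar> + 1 / 2" unfolding r_def of_int_abs by linarith
  hence "r \<le> 2 * \<bar>x\<bar>" using r1 by linarith
  hence "r\<^sup>2 \<le> (2 * \<bar>x\<bar>)\<^sup>2" using r1 by (intro power_mono) auto
  moreover have "r * 1 \<le> r * r" using r1 by (intro mult_left_mono) auto
  ultimately show ?thesis by (simp add: r_def power2_eq_square)
qed simp

text \<open>
  The vectors \<open>a q / t\<close> have small \<open>l\<^sup>2\<close>-norm, so most of their entries round to 0 and the rounded
  vectors have small \<open>l\<^sup>1\<close>-norm. There are few such vectors, and two elements with the same rounded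
  vector differ by at most \<open>t\<close> in every coordinate.
\<close>

lemma close_subset_exists:
  fixes a :: "'q \<Rightarrow> 'j \<Rightarrow> real" and t V :: real
  assumes A: "finite A" and J: "finite J" and t: "t > 0"
    and small: "\<And>q. q \<in> A \<Longrightarrow> (\<Sum>j\<in>J. (a q j)\<^sup>2) \<le> t\<^sup>2 * real Y / 4"
    and many: "V * (2 ^ Y * 3 ^ card J) \<le> real (card A)"
  shows "\<exists>F\<subseteq>A. V \<le> real (card F) \<and> (\<forall>q\<in>F. \<forall>q'\<in>F. \<forall>j\<in>J. \<bar>a q j - a q' j\<bar> \<le> t)"
proof -
  define S where "S = {n \<in> J \<rightarrow>\<^sub>E {-int Y..int Y}. (\<Sum>j\<in>J. \<bar>n j\<bar>) \<le> int Y}"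
  define cell where "cell q = (\<lambda>j\<in>J. round (a q j / t))" for q
  have S: "finite S" "real (card S) \<le> 2 ^ Y * 3 ^ card J"
    using card_small_integer_vectors[OF J, of Y] of_nat_mono[of "card S" "2 ^ Y * 3 ^ card J", where 'a = real]
    by (auto simp: S_def)
  have cellS: "cell q \<in> S" if q: "q \<in> A" for q
  proof -
    have "real_of_int (\<Sum>j\<in>J. \<bar>cell q j\<bar>) \<le> (\<Sum>j\<in>J. 4 * (a q j / t)\<^sup>2)"
      unfolding of_int_sum by (intro sum_mono) (simp add: cell_def round_abs_le_square del: of_int_abs)
    also have "\<dots> = 4 / t\<^sup>2 * (\<Sum>j\<in>J. (a q j)\<^sup>2)"
      by (simp add: power_divide sum_divide_distrib sum_distrib_left)
    also have "\<dots> \<le> 4 / t\<^sup>2 * (t\<^sup>2 * real Y / 4)"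
      using small[OF q] by (intro mult_left_mono) auto
    also have "\<dots> = real Y" using t by simp
    finally have le: "(\<Sum>j\<in>J. \<bar>cell q j\<bar>) \<le> int Y" by linarith
    have "\<bar>cell q j\<bar> \<le> int Y" if "j \<in> J" for j
    proof -
      have "\<bar>cell q j\<bar> \<le> (\<Sum>j\<in>J. \<bar>cell q j\<bar>)" using that J by (intro member_le_sum) auto
      thus ?thesis using le by linarith
    qed
    hence "cell q j \<in> {-int Y..int Y}" if "j \<in> J" for j using that by (fastforce simp: abs_le_iff)
    thus ?thesis using le by (auto simp: S_def cell_def)
  qed
  show ?thesis
  proof (cases "A = {}")
    case True
    have "V \<le> 0"
    proof (rule ccontr)
      assume "\<not> V \<le> 0"
      hence "V * (2 ^ Y * 3 ^ card J) > 0" by simp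
      thus False using many True by simp
    qed
    thus ?thesis using True by auto
  next
    case False
    hence "S \<noteq> {}" using cellS by auto
    then obtain y where y: "card (cell -` {y} \<inter> A) * card S \<ge> card A"
      using pigeonhole_card[of cell A S] cellS A S by blast
    define F where "F = cell -` {y} \<inter> A"
    have "V * (2 ^ Y * 3 ^ card J) \<le> real (card F * card S)"
      using many y unfolding F_def by (meson of_nat_le_iff order_trans)
    also have "\<dots> \<le> real (card F) * (2 ^ Y * 3 ^ card J)"
      unfolding of_nat_mult by (intro mult_left_mono S) auto
    finally have "V \<le> real (card F)" by simp
    moreover have "\<bar>a q j - a q' j\<bar> \<le> t" if "q \<in> F" "q' \<in> F" "j \<in> J" for q q' j
    proof -
      have "cell q j = cell q' j" using that by (simp add: F_def)
      hence "round (a q j / t) = round (a q' j / t)" using that by (simp add: cell_def)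
      hence "\<bar>a q j / t - a q' j / t\<bar> \<le> 1"
        using of_int_round_abs_le[of "a q j / t"] of_int_round_abs_le[of "a q' j / t"] by linarith
      hence "\<bar>a q j - a q' j\<bar> / t \<le> 1" using t by (simp add: diff_divide_distrib[symmetric] abs_div)
      thus ?thesis using t by (simp add: field_simps)
    qed
    ultimately show ?thesis by (intro exI[of _ F]) (auto simp: F_def)
  qed
qed

section \<open>Norms of the orthogonal polynomials of a symmetric node set\<close>

lemma cpoly_add: "cpoly (f + g) = cpoly f + cpoly g"
  by (rule poly_eqI) (simp add: coeff_map_poly)

lemma cpoly_smult: "cpoly (Polynomial.smult c f) = Polynomial.smult (of_real c) (cpoly f)"
  by (rule poly_eqI) (simp add: coeff_map_poly)

lemma cpoly_sum: "cpoly (\<Sum>k\<in>A. f k) = (\<Sum>k\<in>A. cpoly (f k))"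
  by (rule poly_eqI) (simp add: coeff_map_poly coeff_sum)

lemma degree_cpoly: "degree (cpoly f) = degree f"
  by (rule degree_map_poly) simp

lemma cpoly_eq_0_iff: "cpoly f = 0 \<longleftrightarrow> f = 0"
  by (rule map_poly_eq_0_iff) auto

lemma poly_cpoly_cnj: "poly (cpoly f) (cnj x) = cnj (poly (cpoly f) x)"
  by (induction f) (auto simp: map_poly_pCons)

text \<open>
  The nodes and weights are invariant under complex conjugation, which makes all inner products of
  real polynomials real. The real Gram-Schmidt process therefore yields orthogonality in the complex
  sense that Heine's formula requires.
\<close>

lemma orthogonal_polys_norm_product:
  fixes z :: "'i \<Rightarrow> complex" and w :: "'i \<Rightarrow> real"
  assumes I: "finite I" and w: "\<And>i. i \<in> I \<Longrightarrow> w i > 0" and rich: "N \<le> card (z ` I)"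
    and \<tau>: "bij_betw \<tau> I I" "\<And>i. i \<in> I \<Longrightarrow> z (\<tau> i) = cnj (z i)" "\<And>i. i \<in> I \<Longrightarrow> w (\<tau> i) = w i"
    and V: "\<And>g. (\<And>a. a < N \<Longrightarrow> g a \<in> I) \<Longrightarrow> (\<Prod>b<N. \<Prod>a<b. cmod (z (g b) - z (g a)))\<^sup>2 \<le> V"
    and W: "(\<Sum>i\<in>I. w i) \<le> W"
  shows "\<exists>p h. (\<forall>k. degree (p k) = k \<and> lead_coeff (p k) = 1) \<and> (\<forall>k<N. h k > 0) \<and>
      (\<forall>c. (\<Sum>i\<in>I. w i * (cmod (poly (cpoly (\<Sum>k<N. Polynomial.smult (c k) (p k))) (z i)))\<^sup>2)
             = (\<Sum>k<N. (c k)\<^sup>2 * h k)) \<and>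
      fact N * (\<Prod>k<N. h k) \<le> W ^ N * V"
proof -
  let ?e = "\<lambda>f i. poly (cpoly f) (z i)"
  define H where "H f g = (\<Sum>i\<in>I. of_real (w i) * (?e f i * cnj (?e g i)))" for f g
  have H_real: "cnj (H f g) = H f g" for f g
  proof -
    have "cnj (H f g) = (\<Sum>i\<in>I. of_real (w (\<tau> i)) * (?e f (\<tau> i) * cnj (?e g (\<tau> i))))"
      unfolding H_def cnj_sum by (intro sum.cong refl) (simp add: \<tau> poly_cpoly_cnj)
    also have "\<dots> = H f g"
      unfolding H_def by (rule sum.reindex_bij_betw[OF \<tau>(1), of "\<lambda>i. of_real (w i) * (?e f i * cnj (?e g i))"])
    finally show ?thesis .
  qed
  define ip where "ip f g = Re (H f g)" for f g
  have H_ip: "H f g = of_real (ip f g)" for f g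
    using H_real[of f g] by (simp add: ip_def complex_eq_iff)
  have ip_self: "ip f f = (\<Sum>i\<in>I. w i * (cmod (?e f i))\<^sup>2)" for f
    unfolding ip_def H_def by (simp add: complex_mult_cnj cmod_power2)
  have "\<exists>p. (\<forall>k. degree (p k) = k \<and> lead_coeff (p k) = 1) \<and> (\<forall>j<N. \<forall>k<N. j \<noteq> k \<longrightarrow> ip (p j) (p k) = 0)"
  proof (rule orthogonal_monic_polys_exist)
    show "ip (f + g) h = ip f h + ip g h" for f g h
      by (simp add: ip_def H_def cpoly_add ring_distribs sum.distrib)
    show "ip (Polynomial.smult c f) h = c * ip f h" for c f h
      by (simp add: ip_def H_def cpoly_smult sum_distrib_left mult_ac right_diff_distrib)
    show "ip f g = ip g f" for f g
    proof -
      have "H f g = cnj (H g f)" unfolding H_def cnj_sum by (intro sum.cong refl) (simp add: mult_ac)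
      thus ?thesis by (simp add: ip_def)
    qed
    show "ip f f > 0" if f: "f \<noteq> 0" "degree f < N" for f
    proof -
      have f0: "cpoly f \<noteq> 0" using f by (simp add: cpoly_eq_0_iff)
      have "\<exists>i\<in>I. ?e f i \<noteq> 0"
      proof (rule ccontr)
        assume "\<not> ?thesis"
        hence "card (z ` I) \<le> card {x. poly (cpoly f) x = 0}"
          using f0 by (intro card_mono poly_roots_finite) auto
        also have "\<dots> \<le> degree f" using card_poly_roots_bound[OF f0] by (simp add: degree_cpoly)
        finally show False using rich f(2) by linarith
      qed
      then obtain i where i: "i \<in> I" "?e f i \<noteq> 0" by blast
      show ?thesis unfolding ip_self
        using i w I by (intro sum_pos2[of _ i]) (auto intro!: mult_pos_pos mult_nonneg_nonneg simp: less_imp_le)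
    qed
  qed
  then obtain p where p: "\<And>k. degree (p k) = k" "\<And>k. lead_coeff (p k) = 1"
    and orth: "\<And>j k. j < N \<Longrightarrow> k < N \<Longrightarrow> j \<noteq> k \<Longrightarrow> ip (p j) (p k) = 0"
    by blast
  define h where "h k = ip (p k) (p k)" for k
  have h_nonneg: "h k \<ge> 0" for k unfolding h_def ip_self using w by (intro sum_nonneg mult_nonneg_nonneg) (auto simp: less_imp_le)
  have h_pos: "h k > 0" if k: "k < N" for k
  proof -
    have f0: "cpoly (p k) \<noteq> 0" using p(2)[of k] unfolding cpoly_eq_0_iff by force
    have "\<exists>i\<in>I. ?e (p k) i \<noteq> 0"
    proof (rule ccontr)
      assume "\<not> ?thesis"
      hence "card (z ` I) \<le> card {x. poly (cpoly (p k)) x = 0}"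
        using f0 by (intro card_mono poly_roots_finite) auto
      also have "\<dots> \<le> degree (p k)" using card_poly_roots_bound[OF f0] by (simp add: degree_cpoly)
      finally show False using rich k p(1) by simp
    qed
    then obtain i where i: "i \<in> I" "?e (p k) i \<noteq> 0" by blast
    show ?thesis unfolding h_def ip_self
      using i w I by (intro sum_pos2[of _ i]) (auto intro!: mult_pos_pos mult_nonneg_nonneg simp: less_imp_le)
  qed
  have orthH: "(\<Sum>i\<in>I. of_real (w i) * (?e (p j) i * cnj (?e (p k) i))) = (if j = k then of_real (h j) else 0)"
    if "j < N" "k < N" for j k
    using orth[OF that] H_ip[of "p j" "p k"] unfolding H_def h_def by auto
  have pyth: "(\<Sum>i\<in>I. w i * (cmod (?e (\<Sum>k<N. Polynomial.smult (c k) (p k)) i))\<^sup>2) = (\<Sum>k<N. (c k)\<^sup>2 * h k)" for c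
  proof -
    have ev: "?e (\<Sum>k<N. Polynomial.smult (c k) (p k)) i = (\<Sum>k<N. of_real (c k) * ?e (p k) i)" for i
      by (simp add: cpoly_sum cpoly_smult poly_sum)
    have sq: "(\<Sum>j<N. of_real (c j) * ?e (p j) i) * cnj (\<Sum>k<N. of_real (c k) * ?e (p k) i)
        = (\<Sum>j<N. \<Sum>k<N. of_real (c j) * of_real (c k) * (?e (p j) i * cnj (?e (p k) i)))" for i
      unfolding cnj_sum sum_product by (intro sum.cong refl) simp
    have "complex_of_real (\<Sum>i\<in>I. w i * (cmod (?e (\<Sum>k<N. Polynomial.smult (c k) (p k)) i))\<^sup>2)
        = (\<Sum>i\<in>I. \<Sum>j<N. \<Sum>k<N. of_real (c j) * of_real (c k) * (of_real (w i) * (?e (p j) i * cnj (?e (p k) i))))"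
      unfolding of_real_sum of_real_mult complex_norm_square ev sq sum_distrib_left
      by (intro sum.cong refl) (simp only: mult_ac)
    also have "\<dots> = (\<Sum>j<N. \<Sum>k<N. of_real (c j) * of_real (c k) * (\<Sum>i\<in>I. of_real (w i) * (?e (p j) i * cnj (?e (p k) i))))"
      unfolding sum_distrib_left by (subst sum.swap) (intro sum.cong refl sum.swap)
    also have "\<dots> = (\<Sum>j<N. \<Sum>k<N. if k = j then of_real (c j) * of_real (c j) * of_real (h j) else 0)"
      using orthH by (intro sum.cong refl) auto
    also have "\<dots> = complex_of_real (\<Sum>k<N. (c k)\<^sup>2 * h k)"
      by (simp add: power2_eq_square)
    finally show ?thesis by (simp only: of_real_eq_iff)
  qed
  have "fact N * (\<Prod>k<N. h k) = (\<Sum>g\<in>{0..<N} \<rightarrow>\<^sub>E I. (\<Prod>a<N. w (g a)) *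
          (cmod (Determinant.det (mat N N (\<lambda>(a, j). ?e (p j) (g a)))))\<^sup>2)"
    by (rule sum_weighted_det_square[OF I orthH, symmetric])
  also have "\<dots> \<le> (\<Sum>g\<in>{0..<N} \<rightarrow>\<^sub>E I. (\<Prod>a<N. w (g a)) * V)"
  proof (intro sum_mono mult_left_mono prod_nonneg)
    fix g assume g: "g \<in> {0..<N} \<rightarrow>\<^sub>E I"
    have "Determinant.det (mat N N (\<lambda>(a, j). ?e (p j) (g a))) = (\<Prod>b<N. \<Prod>a<b. z (g b) - z (g a))"
      using det_polys_eq_vandermonde[of "\<lambda>k. cpoly (p k)" N "\<lambda>a. z (g a)"] p
      by (simp add: degree_cpoly coeff_map_poly)
    moreover have "(\<Prod>b<N. \<Prod>a<b. cmod (z (g b) - z (g a)))\<^sup>2 \<le> V"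
      using g by (intro V) auto
    ultimately show "(cmod (Determinant.det (mat N N (\<lambda>(a, j). ?e (p j) (g a)))))\<^sup>2 \<le> V"
      by (simp add: prod_norm[symmetric])
  next
    fix g a assume "g \<in> {0..<N} \<rightarrow>\<^sub>E I" "a \<in> {..<N}"
    hence "g a \<in> I" by auto
    thus "0 \<le> w (g a)" using w by (simp add: less_imp_le)
  qed
  also have "\<dots> = (\<Sum>i\<in>I. w i) ^ N * V"
  proof -
    have "(\<Sum>i\<in>I. w i) ^ N = (\<Prod>a\<in>{0..<N}. \<Sum>i\<in>I. w i)" by simp
    also have "\<dots> = (\<Sum>g\<in>{0..<N} \<rightarrow>\<^sub>E I. \<Prod>a\<in>{0..<N}. w (g a))"
      using I by (intro prod_sum_PiE) auto
    finally show ?thesis by (simp only: sum_distrib_right lessThan_atLeast0)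
  qed
  also have "\<dots> \<le> W ^ N * V"
  proof -
    have "V \<ge> 0"
    proof (cases "N = 0")
      case True
      thus ?thesis using V[of undefined] by simp
    next
      case False
      hence "I \<noteq> {}" using rich by auto
      then obtain i where "i \<in> I" by blast
      thus ?thesis using V[of "\<lambda>_. i"] by (meson order_trans zero_le_power2)
    qed
    thus ?thesis using W w by (intro mult_right_mono power_mono sum_nonneg) (auto simp: less_imp_le)
  qed
  finally have bound: "fact N * (\<Prod>k<N. h k) \<le> W ^ N * V" .
  show ?thesis using p h_pos pyth bound by blast
qed

section \<open>From coefficients to values at negative integers\<close>

text \<open>
  The coefficients of \<open>q (- 1 - u)\<close> when \<open>d\<close> are those of \<open>q (u)\<close>. This substitution corresponds to
  \<open>x \<mapsto> - 1 - x\<close> on the side of the values, so it reduces negative arguments to natural ones.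
\<close>

definition reflect_coeffs :: "(nat \<Rightarrow> real) \<Rightarrow> nat \<Rightarrow> nat \<Rightarrow> real" where
  "reflect_coeffs d N j = (\<Sum>k<N. (-1) ^ k * d k * real (k choose j))"

lemma newton_gf_eq:
  assumes "y \<noteq> 1"
  shows "newton_gf d N y = (1 / (1 - y)) * (\<Sum>k<N. of_real (d k) * (y / (1 - y)) ^ k)"
  unfolding newton_gf_def sum_distrib_left using assms
  by (intro sum.cong refl) (simp add: power_divide mult_ac)

lemma newton_gf_reflect_eq:
  assumes "y \<noteq> 1"
  shows "newton_gf (reflect_coeffs d N) N y = (1 / (1 - y)) * (\<Sum>k<N. of_real (d k) * (- (1 / (1 - y))) ^ k)"
proof -
  define u where "u = y / (1 - y)"
  have u: "u + 1 = 1 / (1 - y)" using assms by (simp add: u_def field_simps)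
  have inner: "(\<Sum>j<N. of_nat (k choose j) * u ^ j) = (u + 1) ^ k" if k: "k < N" for k
  proof -
    have "(\<Sum>j<N. of_nat (k choose j) * u ^ j) = (\<Sum>j\<le>k. of_nat (k choose j) * u ^ j)"
      using k by (intro sum.mono_neutral_right) (auto simp: binomial_eq_0)
    also have "\<dots> = (u + 1) ^ k" by (simp add: binomial_ring)
    finally show ?thesis .
  qed
  have "(\<Sum>j<N. of_real (reflect_coeffs d N j) * u ^ j)
      = (\<Sum>j<N. \<Sum>k<N. of_real ((-1) ^ k * d k) * (of_nat (k choose j) * u ^ j))"
    by (simp add: reflect_coeffs_def sum_distrib_right mult.assoc)
  also have "\<dots> = (\<Sum>k<N. of_real ((-1) ^ k * d k) * (\<Sum>j<N. of_nat (k choose j) * u ^ j))"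
    unfolding sum_distrib_left by (rule sum.swap)
  also have "\<dots> = (\<Sum>k<N. of_real (d k) * (- (u + 1)) ^ k)"
  proof (intro sum.cong refl)
    fix k assume "k \<in> {..<N}"
    hence "k < N" by simp
    thus "of_real ((-1) ^ k * d k) * (\<Sum>j<N. of_nat (k choose j) * u ^ j) = of_real (d k) * (- (u + 1)) ^ k"
      unfolding inner[OF \<open>k < N\<close>] power_minus[of "u + 1"] by simp
  qed
  finally show ?thesis using newton_gf_eq[OF assms, of "reflect_coeffs d N" N] by (simp add: u_def[symmetric] u)
qed

definition binomial_poly :: "nat \<Rightarrow> real poly" where
  "binomial_poly k = Polynomial.smult (1 / fact k) (\<Prod>i = 0..<k. [:- of_nat i, 1:])"

lemma poly_binomial_poly: "poly (binomial_poly k) x = x gchoose k"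
  by (simp add: binomial_poly_def poly_prod gbinomial_prod_rev)

definition newton_poly :: "(nat \<Rightarrow> real) \<Rightarrow> nat \<Rightarrow> real poly" where
  "newton_poly d N = (\<Sum>k<N. Polynomial.smult (d k) (binomial_poly k))"

lemma poly_newton_poly_nat: "poly (newton_poly d N) (of_nat n) = newton d N n"
  by (simp add: newton_poly_def poly_sum poly_binomial_poly newton_def binomial_gbinomial)

lemma negative_gbinomial:
  "(- of_nat (Suc m) gchoose k :: real) = (-1) ^ k * (\<Sum>j\<le>k. real (k choose j) * real (m choose j))"
proof -
  have "(- of_nat (Suc m) gchoose k :: real) = (-1) ^ k * (of_nat (m + k) gchoose k)"
    by (subst gbinomial_minus) (simp add: add_ac)
  also have "(of_nat (m + k) gchoose k :: real) = real ((m + k) choose k)"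
    by (simp add: binomial_gbinomial)
  also have "(m + k) choose k = (\<Sum>j\<le>k. (m choose j) * (k choose (k - j)))"
    by (rule vandermonde[symmetric])
  also have "\<dots> = (\<Sum>j\<le>k. (k choose j) * (m choose j))"
    by (intro sum.cong refl) (simp add: binomial_symmetric[symmetric])
  finally show ?thesis by simp
qed

lemma poly_newton_poly_negative:
  "poly (newton_poly d N) (- of_nat (Suc m)) = newton (reflect_coeffs d N) N m"
proof -
  have inner: "(\<Sum>j\<le>k. real (k choose j) * real (m choose j)) = (\<Sum>j<N. real (k choose j) * real (m choose j))"
    if "k < N" for k
    using that by (intro sum.mono_neutral_left) (auto simp: binomial_eq_0)
  have "poly (newton_poly d N) (- of_nat (Suc m))
      = (\<Sum>k<N. d k * (- of_nat (Suc m) gchoose k))"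
    by (simp add: newton_poly_def poly_sum poly_binomial_poly del: of_nat_Suc)
  also have "\<dots> = (\<Sum>k<N. \<Sum>j<N. (-1) ^ k * d k * real (k choose j) * real (m choose j))"
    unfolding negative_gbinomial
    by (intro sum.cong refl) (simp add: inner sum_distrib_left mult_ac)
  also have "\<dots> = newton (reflect_coeffs d N) N m"
    unfolding newton_def reflect_coeffs_def sum_distrib_right by (rule sum.swap)
  finally show ?thesis .
qed

section \<open>The two disks\<close>

lemma power_over_fact_le: "real N ^ N / fact N \<le> exp 1 ^ N"
proof -
  have "real N ^ N / fact N \<le> exp (real N)"
  proof -
    have "(\<Sum>n\<in>{N}. real N ^ n /\<^sub>R fact n) \<le> (\<Sum>n. real N ^ n /\<^sub>R fact n)"
      by (intro sum_le_suminf summable_exp_generic) auto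
    thus ?thesis by (simp add: exp_def field_simps)
  qed
  thus ?thesis by (simp add: exp_of_nat_mult[symmetric])
qed

text \<open>
  On the circle \<open>|y| = 1/A\<close> one has \<open>1 = A\<^sup>2 * y * cnj y\<close>, so the distance of \<open>y / (1 - y)\<close> from the
  centre of the disk is equal to its radius.
\<close>

lemma disk1_point:
  assumes A: "A > 1" and y: "cmod y = 1 / A"
  shows "y / (1 - y) \<in> disk1 A"
proof -
  have A2: "A\<^sup>2 - 1 > 0" using A by (simp add: power2_eq_square less_1_mult)
  have y1: "y \<noteq> 1" using A y by auto
  have yy: "of_real (A\<^sup>2) * (y * cnj y) = 1"
    using A y by (simp add: complex_norm_square[symmetric] power_divide flip: of_real_mult)
  have "of_real (1 / (A\<^sup>2 - 1)) - y / (1 - y) = (1 - of_real (A\<^sup>2) * y) / (of_real (A\<^sup>2 - 1) * (1 - y))"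
  proof -
    define D where "D = complex_of_real (A\<^sup>2 - 1)"
    have D: "D \<noteq> 0" using A2 by (simp only: D_def of_real_eq_0_iff)
    have "of_real (1 / (A\<^sup>2 - 1)) - y / (1 - y) = 1 / D - y / (1 - y)" by (simp add: D_def)
    also have "\<dots> = (1 * (1 - y) - y * D) / (D * (1 - y))" using D y1 by (intro diff_frac_eq) auto
    also have "1 * (1 - y) - y * D = 1 - of_real (A\<^sup>2) * y" by (simp add: D_def algebra_simps)
    finally show ?thesis by (simp only: D_def)
  qed
  also have "1 - of_real (A\<^sup>2) * y = - (of_real (A\<^sup>2) * y * cnj (1 - y))"
    using yy by (simp add: algebra_simps)
  finally have "cmod (of_real (1 / (A\<^sup>2 - 1)) - y / (1 - y))
      = (A\<^sup>2 * cmod y * cmod (1 - y)) / ((A\<^sup>2 - 1) * cmod (1 - y))"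
    using A2 by (simp only: norm_divide norm_mult norm_minus_cancel complex_mod_cnj norm_of_real) simp
  also have "\<dots> = A / (A\<^sup>2 - 1)" using y1 A by (simp add: y power2_eq_square)
  finally show ?thesis by (simp add: disk1_def dist_norm)
qed

text \<open>
  The reflection \<open>u \<mapsto> - 1 - u\<close> maps \<open>disk1 B\<close> to \<open>disk2 B\<close>.
\<close>

lemma disk2_point:
  assumes B: "B > 1" and y: "cmod y = 1 / B"
  shows "- (1 / (1 - y)) \<in> disk2 B"
proof -
  have "y / (1 - y) \<in> disk1 B" by (rule disk1_point[OF B y])
  moreover have "of_real (B\<^sup>2 / (1 - B\<^sup>2)) - - (1 / (1 - y)) = - (of_real (1 / (B\<^sup>2 - 1)) - y / (1 - y))"
  proof -
    have B2: "B\<^sup>2 - 1 > 0" using B by (simp add: power2_eq_square less_1_mult)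
    have y1: "1 - y \<noteq> 0" using B y by auto
    have "1 / (1 - y) = 1 + y / (1 - y)" using y1 by (simp add: field_simps)
    moreover have "B\<^sup>2 / (1 - B\<^sup>2) = - 1 - 1 / (B\<^sup>2 - 1)" using B2 by (simp add: field_simps)
    ultimately show ?thesis by simp
  qed
  ultimately show ?thesis by (simp only: disk1_def disk2_def mem_cball dist_norm norm_minus_cancel)
qed

lemma disks_vandermonde_le:
  assumes A: "A > 1" and B: "B > 1" and \<gamma>: "gamma_AB A B = 1"
  shows "\<exists>\<kappa>>0. \<forall>N>0. \<forall>z. (\<forall>i<N. z i \<in> disk1 A \<union> disk2 B) \<longrightarrow>
           (\<Prod>j<N. \<Prod>i<j. cmod (z j - z i))\<^sup>2 \<le> (\<kappa> * real N) ^ N"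
  unfolding disk1_def disk2_def
proof (rule two_disks_vandermonde_le)
  have A2: "A\<^sup>2 - 1 > 0" and B2: "B\<^sup>2 - 1 > 0" using A B by (simp_all add: power2_eq_square less_1_mult)
  show "log_capacity (cball (of_real (1 / (A\<^sup>2 - 1))) (A / (A\<^sup>2 - 1)) \<union>
      cball (of_real (B\<^sup>2 / (1 - B\<^sup>2))) (B / (B\<^sup>2 - 1))) = 1"
    using \<gamma> by (simp only: gamma_AB_def disk1_def disk2_def)
  show "A / (A\<^sup>2 - 1) > 0" "B / (B\<^sup>2 - 1) > 0" using A B A2 B2 by auto
  have "A / (A\<^sup>2 - 1) - 1 / (A\<^sup>2 - 1) = 1 / (A + 1)"
  proof -
    have "A\<^sup>2 - 1 = (A - 1) * (A + 1)" by (simp add: power2_eq_square algebra_simps)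
    thus ?thesis using A by (simp add: diff_divide_distrib[symmetric])
  qed
  also have "\<dots> < 1 / 2" using A by (simp add: field_simps)
  also have "\<dots> < B / (B + 1)" using B by (simp add: field_simps)
  also have "B / (B + 1) = B\<^sup>2 / (B\<^sup>2 - 1) - B / (B\<^sup>2 - 1)"
  proof -
    have "B\<^sup>2 - 1 = (B - 1) * (B + 1)" "B\<^sup>2 - B = (B - 1) * B" by (simp_all add: power2_eq_square algebra_simps)
    thus ?thesis using B by (simp add: diff_divide_distrib[symmetric])
  qed
  finally have "A / (A\<^sup>2 - 1) + B / (B\<^sup>2 - 1) < 1 / (A\<^sup>2 - 1) + B\<^sup>2 / (B\<^sup>2 - 1)" by linarith
  also have "\<dots> = 1 / (A\<^sup>2 - 1) - B\<^sup>2 / (1 - B\<^sup>2)"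
    using B2 by (metis minus_diff_eq minus_divide_right diff_minus_eq_add)
  also have "\<dots> \<le> dist (complex_of_real (1 / (A\<^sup>2 - 1))) (complex_of_real (B\<^sup>2 / (1 - B\<^sup>2)))"
    unfolding dist_norm of_real_diff[symmetric] norm_of_real by (rule abs_ge_self)
  finally show "A / (A\<^sup>2 - 1) + B / (B\<^sup>2 - 1) < \<dots>" .
qed

section \<open>Assembling the polynomials\<close>

lemma poly_cpoly_eq_sum:
  assumes "\<And>k. k \<ge> N \<Longrightarrow> coeff q k = 0"
  shows "poly (cpoly q) x = (\<Sum>k<N. of_real (coeff q k) * x ^ k)"
proof -
  have "poly (cpoly q) x = (\<Sum>k\<le>degree q. of_real (coeff q k) * x ^ k)"
    by (simp add: poly_altdef degree_cpoly coeff_map_poly)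
  also have "\<dots> = (\<Sum>k\<in>{..degree q} \<union> {..<N}. of_real (coeff q k) * x ^ k)"
    by (intro sum.mono_neutral_left) (auto simp: coeff_eq_0)
  also have "\<dots> = (\<Sum>k<N. of_real (coeff q k) * x ^ k)"
    using assms by (intro sum.mono_neutral_right) auto
  finally show ?thesis .
qed

lemma newton_diff: "newton (coeff (q - r)) N m = newton (coeff q) N m - newton (coeff r) N m"
  by (simp add: newton_def left_diff_distrib sum_subtractf)

lemma reflect_coeffs_diff:
  "newton (reflect_coeffs (coeff (q - r)) N) N m
     = newton (reflect_coeffs (coeff q) N) N m - newton (reflect_coeffs (coeff r) N) N m"
  by (simp add: newton_def reflect_coeffs_def left_diff_distrib right_diff_distrib sum_subtractf)

text \<open>
  The nodes are the images of the \<open>M\<close>-th roots of unity on the boundaries of both disks. At such a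
  node each of the two generating functions is the value of \<open>q\<close> times \<open>1 / (1 - y)\<close>; the squared
  modulus of this factor, divided by \<open>M\<close>, is taken as the weight, so that the squared norm of \<open>q\<close>
  is the sum of the mean squares of the two generating functions.
\<close>

lemma orthogonal_system_on_disks:
  fixes A B \<kappa> :: real
  assumes A: "A > 1" and B: "B > 1"
    and \<kappa>: "\<And>z. (\<And>i. i < N \<Longrightarrow> z i \<in> disk1 A \<union> disk2 B) \<Longrightarrow>
           (\<Prod>j<N. \<Prod>i<j. cmod (z j - z i))\<^sup>2 \<le> (\<kappa> * real N) ^ N"
    and N: "N > 0" and M: "M \<ge> N"
  obtains p h where "\<forall>k. degree (p k) = k" and "\<forall>k. lead_coeff (p k) = 1" and "\<forall>k<N. h k > 0"
    and "\<forall>c q. q = (\<Sum>k<N. Polynomial.smult (c k) (p k)) \<longrightarrow>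
           circle_mean (coeff q) N M A + circle_mean (reflect_coeffs (coeff q) N) N M B
             = (\<Sum>k<N. (c k)\<^sup>2 * h k)"
    and "fact N * (\<Prod>k<N. h k)
           \<le> ((1 / (1 - 1 / A))\<^sup>2 + (1 / (1 - 1 / B))\<^sup>2) ^ N * (\<kappa> * real N) ^ N"
proof -
  define W where "W = (1 / (1 - 1 / A))\<^sup>2 + (1 / (1 - 1 / B))\<^sup>2"
  have M0: "M > 0" using M N by simp
  define U where "U = {\<zeta> :: complex. \<zeta> ^ M = 1}"
  have bijU: "bij_betw (\<lambda>j. cis (2 * pi * real j / real M)) {..<M} U"
    unfolding U_def by (rule Complex.bij_betw_roots_unity[OF M0])
  have finU: "finite U" and cardU: "card U = M"
    using bij_betw_finite[OF bijU] bij_betw_same_card[OF bijU] by auto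
  have normU: "cmod \<zeta> = 1" if "\<zeta> \<in> U" for \<zeta>
  proof -
    have "cmod \<zeta> ^ M = 1" using that by (simp add: U_def flip: norm_power)
    thus ?thesis using M0 power_eq_imp_eq_base[of "cmod \<zeta>" M 1] by simp
  qed
  have cnjU: "cnj \<zeta> \<in> U" if "\<zeta> \<in> U" for \<zeta>
    using that by (simp add: U_def flip: complex_cnj_power)
  define y where "y r \<zeta> = \<zeta> / complex_of_real r" for r \<zeta>
  have ny: "cmod (y r \<zeta>) = 1 / r" if "r > 1" "\<zeta> \<in> U" for r \<zeta>
    using that normU[OF that(2)] by (simp add: y_def norm_divide)
  have y1: "y r \<zeta> \<noteq> 1" if "r > 1" "\<zeta> \<in> U" for r \<zeta>
    using ny[OF that] that(1) by auto
  have y_cnj: "y r (cnj \<zeta>) = cnj (y r \<zeta>)" for r \<zeta> by (simp add: y_def)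
  define z where "z = case_sum (\<lambda>\<zeta>. y A \<zeta> / (1 - y A \<zeta>)) (\<lambda>\<zeta>. - (1 / (1 - y B \<zeta>)))"
  define w where "w = case_sum (\<lambda>\<zeta>. (cmod (1 / (1 - y A \<zeta>)))\<^sup>2 / real M) (\<lambda>\<zeta>. (cmod (1 / (1 - y B \<zeta>)))\<^sup>2 / real M)"
  define I where "I = U <+> U"
  have wbound: "(cmod (1 / (1 - y r \<zeta>)))\<^sup>2 \<le> (1 / (1 - 1 / r))\<^sup>2" if "r > 1" "\<zeta> \<in> U" for r \<zeta>
  proof -
    have "1 - 1 / r \<le> cmod (1 - y r \<zeta>)"
      using norm_triangle_ineq2[of 1 "y r \<zeta>"] ny[OF that] by simp
    hence "1 / cmod (1 - y r \<zeta>) \<le> 1 / (1 - 1 / r)" using that(1) by (intro divide_left_mono mult_pos_pos) auto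
    thus ?thesis by (intro power_mono) (auto simp: norm_divide)
  qed
  have "\<exists>p h. (\<forall>k. degree (p k) = k \<and> lead_coeff (p k) = 1) \<and> (\<forall>k<N. h k > 0) \<and>
      (\<forall>c. (\<Sum>i\<in>I. w i * (cmod (poly (cpoly (\<Sum>k<N. Polynomial.smult (c k) (p k))) (z i)))\<^sup>2)
             = (\<Sum>k<N. (c k)\<^sup>2 * h k)) \<and>
      fact N * (\<Prod>k<N. h k) \<le> W ^ N * (\<kappa> * real N) ^ N"
  proof (rule orthogonal_polys_norm_product)
    show "finite I" using finU by (simp add: I_def)
    show "w i > 0" if "i \<in> I" for i
      using that y1[OF A] y1[OF B] M0 by (auto simp: I_def w_def)
    show "N \<le> card (z ` I)"
    proof -
      have "inj_on (\<lambda>\<zeta>. z (Inl \<zeta>)) U"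
      proof (rule inj_onI)
        fix \<zeta> \<zeta>' assume h: "\<zeta> \<in> U" "\<zeta>' \<in> U" "z (Inl \<zeta>) = z (Inl \<zeta>')"
        have "y A \<zeta> / (1 - y A \<zeta>) = y A \<zeta>' / (1 - y A \<zeta>')" using h(3) by (simp add: z_def)
        hence "y A \<zeta> * (1 - y A \<zeta>') = y A \<zeta>' * (1 - y A \<zeta>)"
          using y1[OF A h(1)] y1[OF A h(2)] by (subst (asm) frac_eq_eq) auto
        hence "y A \<zeta> = y A \<zeta>'" by (simp add: right_diff_distrib mult.commute)
        thus "\<zeta> = \<zeta>'" using A by (simp add: y_def)
      qed
      hence "card ((\<lambda>\<zeta>. z (Inl \<zeta>)) ` U) = M" by (simp add: card_image cardU)
      moreover have "card ((\<lambda>\<zeta>. z (Inl \<zeta>)) ` U) \<le> card (z ` I)"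
        using finU by (intro card_mono) (auto simp: I_def)
      ultimately show ?thesis using M by simp
    qed
    show "bij_betw (map_sum cnj cnj) I I"
      by (rule bij_betw_byWitness[of _ "map_sum cnj cnj"]) (use cnjU in \<open>auto simp: I_def\<close>)
    show "z (map_sum cnj cnj i) = cnj (z i)" if "i \<in> I" for i
      by (cases i) (auto simp: z_def y_cnj)
    show "w (map_sum cnj cnj i) = w i" if "i \<in> I" for i
    proof -
      have "cmod (1 - cnj x) = cmod (1 - x)" for x using complex_mod_cnj[of "1 - x"] by simp
      thus ?thesis by (cases i) (auto simp: w_def y_cnj norm_divide)
    qed
    show "(\<Prod>b<N. \<Prod>a<b. cmod (z (g b) - z (g a)))\<^sup>2 \<le> (\<kappa> * real N) ^ N"
      if "\<And>a. a < N \<Longrightarrow> g a \<in> I" for g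
    proof (rule \<kappa>)
      fix a assume "a < N"
      hence "g a \<in> I" by (rule that)
      thus "z (g a) \<in> disk1 A \<union> disk2 B"
        using disk1_point[OF A ny[OF A]] disk2_point[OF B ny[OF B]] by (auto simp: I_def z_def)
    qed
    show "(\<Sum>i\<in>I. w i) \<le> W"
    proof -
      have "(\<Sum>i\<in>I. w i) = (\<Sum>\<zeta>\<in>U. (cmod (1 / (1 - y A \<zeta>)))\<^sup>2 / real M) + (\<Sum>\<zeta>\<in>U. (cmod (1 / (1 - y B \<zeta>)))\<^sup>2 / real M)"
        unfolding I_def w_def by (simp add: sum.Plus[OF finU finU])
      also have "\<dots> \<le> (\<Sum>\<zeta>\<in>U. (1 / (1 - 1 / A))\<^sup>2 / real M) + (\<Sum>\<zeta>\<in>U. (1 / (1 - 1 / B))\<^sup>2 / real M)"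
        by (intro add_mono sum_mono divide_right_mono wbound A B) auto
      also have "\<dots> = W" using M0 by (simp add: cardU W_def)
      finally show ?thesis .
    qed
  qed
  then obtain p h where p: "\<And>k. degree (p k) = k" "\<And>k. lead_coeff (p k) = 1"
    and h: "\<And>k. k < N \<Longrightarrow> h k > 0"
    and pyth: "\<And>c. (\<Sum>i\<in>I. w i * (cmod (poly (cpoly (\<Sum>k<N. Polynomial.smult (c k) (p k))) (z i)))\<^sup>2)
             = (\<Sum>k<N. (c k)\<^sup>2 * h k)"
    and bound: "fact N * (\<Prod>k<N. h k) \<le> W ^ N * (\<kappa> * real N) ^ N"
    by blast
  have "circle_mean (coeff q) N M A + circle_mean (reflect_coeffs (coeff q) N) N M B
             = (\<Sum>k<N. (c k)\<^sup>2 * h k)" if q: "q = (\<Sum>k<N. Polynomial.smult (c k) (p k))" for c q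
  proof -
    have zero: "coeff q k = 0" if "k \<ge> N" for k
      unfolding q coeff_sum using that by (auto intro!: sum.neutral simp: p coeff_eq_0)
    have ev: "poly (cpoly q) x = (\<Sum>k<N. of_real (coeff q k) * x ^ k)" for x
      by (rule poly_cpoly_eq_sum[OF zero])
    have "(\<Sum>k<N. (c k)\<^sup>2 * h k) = (\<Sum>i\<in>I. w i * (cmod (poly (cpoly q) (z i)))\<^sup>2)"
      using pyth[of c] q by simp
    also have "\<dots> = (\<Sum>\<zeta>\<in>U. (cmod (1 / (1 - y A \<zeta>)))\<^sup>2 / real M * (cmod (poly (cpoly q) (y A \<zeta> / (1 - y A \<zeta>))))\<^sup>2) +
        (\<Sum>\<zeta>\<in>U. (cmod (1 / (1 - y B \<zeta>)))\<^sup>2 / real M * (cmod (poly (cpoly q) (- (1 / (1 - y B \<zeta>)))))\<^sup>2)"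
      unfolding I_def w_def z_def by (simp add: sum.Plus[OF finU finU])
    also have "\<dots> = (\<Sum>\<zeta>\<in>U. 1 / real M * (cmod (newton_gf (coeff q) N (y A \<zeta>)))\<^sup>2) +
        (\<Sum>\<zeta>\<in>U. 1 / real M * (cmod (newton_gf (reflect_coeffs (coeff q) N) N (y B \<zeta>)))\<^sup>2)"
      by (intro arg_cong2[of _ _ _ _ "(+)"] sum.cong refl)
         (simp_all add: newton_gf_eq[OF y1[OF A]] newton_gf_reflect_eq[OF y1[OF B]] ev norm_mult norm_divide power_mult_distrib power_divide)
    also have "(\<Sum>\<zeta>\<in>U. 1 / real M * (cmod (newton_gf (coeff q) N (y A \<zeta>)))\<^sup>2)
        = (\<Sum>j<M. 1 / real M * (cmod (newton_gf (coeff q) N (y A (cis (2 * pi * real j / real M)))))\<^sup>2)"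
      by (rule sum.reindex_bij_betw[OF bijU, symmetric])
    also have "(\<Sum>\<zeta>\<in>U. 1 / real M * (cmod (newton_gf (reflect_coeffs (coeff q) N) N (y B \<zeta>)))\<^sup>2)
        = (\<Sum>j<M. 1 / real M * (cmod (newton_gf (reflect_coeffs (coeff q) N) N (y B (cis (2 * pi * real j / real M)))))\<^sup>2)"
      by (rule sum.reindex_bij_betw[OF bijU, symmetric])
    finally show ?thesis by (simp only: sum_distrib_left y_def circle_mean_def)
  qed
  thus ?thesis using p h bound by (intro that[of p h]) (simp_all add: W_def)
qed

text \<open>
  The integer polynomials of degree below \<open>N\<close> that encode admissible integer-valued polynomials.
  In the second family of bounds the index is shifted: \<open>m\<close> stands for the argument \<open>- 1 - m\<close>.
\<close>

definition bounded_integer_polys :: "real \<Rightarrow> real \<Rightarrow> real \<Rightarrow> nat \<Rightarrow> real poly set" where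
  "bounded_integer_polys A B t N = {q. int_coeffs q \<and> (\<forall>k\<ge>N. coeff q k = 0) \<and>
     (\<forall>m. \<bar>newton (coeff q) N m\<bar> \<le> t * A ^ m) \<and>
     (\<forall>m. \<bar>newton (reflect_coeffs (coeff q) N) N m\<bar> \<le> t * B ^ m)}"

text \<open>
  The order of the choices matters: \<open>K\<close> depends only on \<open>A\<close> and \<open>B\<close>, and \<open>R\<close> is then chosen so large
  that the number \<open>T0^N\<close> of lattice points exceeds the number of rounded vectors by a factor \<open>2^N\<close>.
  Since \<open>t\<close> is proportional to \<open>sqrt R\<close>, that number of vectors does not depend on \<open>R\<close>.
\<close>

lemma many_bounded_integer_polys:
  fixes A B :: real
  assumes A: "A > 1" and B: "B > 1" and \<gamma>: "gamma_AB A B = 1"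
  shows "\<exists>t>0. \<forall>N>0. \<exists>F \<subseteq> bounded_integer_polys A B t N. finite F \<and> 2 ^ N \<le> card F"
proof -
  obtain \<kappa> where \<kappa>: "\<kappa> > 0" and vdm: "\<And>N z. N > 0 \<Longrightarrow> (\<And>i. i < N \<Longrightarrow> z i \<in> disk1 A \<union> disk2 B) \<Longrightarrow>
           (\<Prod>j<N. \<Prod>i<j. cmod (z j - z i))\<^sup>2 \<le> (\<kappa> * real N) ^ N"
    using disks_vandermonde_le[OF A B \<gamma>] by blast
  obtain KA where KA: "KA \<ge> 1"
      "\<forall>N>0. \<forall>M\<ge>KA * N. \<forall>d. (\<Sum>m<M. (newton d N m / A ^ m)\<^sup>2) \<le> 4 * circle_mean d N M A"
      "\<forall>N>0. \<forall>M\<ge>KA * N. \<forall>d t. (\<forall>m<M. \<bar>newton d N m\<bar> \<le> t * A ^ m) \<longrightarrow>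
           (\<forall>m. \<bar>newton d N m\<bar> \<le> t * A ^ m)"
    by (rule newton_sequence_control[OF A])
  obtain KB where KB: "KB \<ge> 1"
      "\<forall>N>0. \<forall>M\<ge>KB * N. \<forall>d. (\<Sum>m<M. (newton d N m / B ^ m)\<^sup>2) \<le> 4 * circle_mean d N M B"
      "\<forall>N>0. \<forall>M\<ge>KB * N. \<forall>d t. (\<forall>m<M. \<bar>newton d N m\<bar> \<le> t * B ^ m) \<longrightarrow>
           (\<forall>m. \<bar>newton d N m\<bar> \<le> t * B ^ m)"
    by (rule newton_sequence_control[OF B])
  define K where "K = max KA KB"
  define W where "W = (1 / (1 - 1 / A))\<^sup>2 + (1 / (1 - 1 / B))\<^sup>2"
  have W: "W > 0" unfolding W_def using A B by (intro add_pos_pos zero_less_power divide_pos_pos) auto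
  define C0 where "C0 = W * \<kappa> * exp 1"
  have C0: "C0 > 0" using W \<kappa> by (simp add: C0_def)
  \<comment> \<open>\<open>2 * 9 ^ K\<close> is the number of rounded vectors per degree of freedom; the other 2 is gained\<close>
  define T0 where "T0 = (4 * 9 ^ K :: real)"
  have T0: "T0 > 0" by (simp add: T0_def)
  define R where "R = C0 * (T0 + 1)\<^sup>2"
  have R: "R > 0" using C0 T0 by (simp add: R_def)
  define t where "t = 4 * sqrt R"
  have t: "t > 0" "t\<^sup>2 = 16 * R" using R by (auto simp: t_def power_mult_distrib)
  have "\<exists>F \<subseteq> bounded_integer_polys A B t N. finite F \<and> 2 ^ N \<le> card F" if N: "N > 0" for N
  proof -
    define M where "M = K * N"
    have MA: "M \<ge> KA * N" and MB: "M \<ge> KB * N" by (auto simp: M_def K_def)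
    have MN: "M \<ge> N" using MA KA(1) by (metis le_trans mult_le_mono1 mult_1)
    obtain p h where sys: "\<forall>k. degree (p k) = k" "\<forall>k. lead_coeff (p k) = 1" "\<forall>k<N. h k > 0"
      and pyth: "\<forall>c q. q = (\<Sum>k<N. Polynomial.smult (c k) (p k)) \<longrightarrow>
           circle_mean (coeff q) N M A + circle_mean (reflect_coeffs (coeff q) N) N M B
             = (\<Sum>k<N. (c k)\<^sup>2 * h k)"
      and bound: "fact N * (\<Prod>k<N. h k) \<le> W ^ N * (\<kappa> * real N) ^ N"
      by (rule orthogonal_system_on_disks[OF A B vdm[OF N] N MN]) (simp_all only: W_def)
    note p = sys(1,2)[rule_format] and h = sys(3)[rule_format]
    have prod_h: "(\<Prod>k<N. h k) > 0" using h by (intro prod_pos) auto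
    have "(\<Prod>k<N. h k) \<le> W ^ N * (\<kappa> * real N) ^ N / fact N" using bound by (simp add: field_simps)
    also have "\<dots> = (W * \<kappa>) ^ N * (real N ^ N / fact N)" by (simp add: power_mult_distrib)
    also have "\<dots> \<le> (W * \<kappa>) ^ N * exp 1 ^ N" using W \<kappa> by (intro mult_left_mono power_over_fact_le) auto
    finally have prod_h_le: "(\<Prod>k<N. h k) \<le> C0 ^ N" by (simp add: C0_def power_mult_distrib)
    \<comment> \<open>each coordinate is allowed to contribute \<open>R\<close> to the mean square\<close>
    define s where "s k = sqrt (R / h k)" for k
    have s: "s k > 0" "(s k)\<^sup>2 = R / h k" if "k < N" for k using h[OF that] R by (auto simp: s_def)
    have T_less: "T0 ^ N < (\<Prod>k<N. s k)"
    proof -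
      have "(T0 + 1) ^ N \<le> (\<Prod>k<N. s k)"
      proof (rule power2_le_imp_le)
        have "((T0 + 1) ^ N)\<^sup>2 = ((T0 + 1)\<^sup>2) ^ N" by (simp add: power_mult[symmetric] mult.commute)
        also have "\<dots> = R ^ N / C0 ^ N" using C0 by (simp add: R_def power_mult_distrib)
        also have "\<dots> \<le> R ^ N / (\<Prod>k<N. h k)"
          using prod_h_le prod_h C0 R by (intro divide_left_mono) auto
        also have "\<dots> = (\<Prod>k<N. (s k)\<^sup>2)" using s(2) by (simp add: prod_dividef)
        also have "\<dots> = (\<Prod>k<N. s k)\<^sup>2" by (rule prod_power_distrib[symmetric])
        finally show "((T0 + 1) ^ N)\<^sup>2 \<le> (\<Prod>k<N. s k)\<^sup>2" .
        show "0 \<le> (\<Prod>k<N. s k)" using s(1) by (intro prod_nonneg) (auto simp: less_imp_le)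
      qed
      moreover have "T0 ^ N < (T0 + 1) ^ N" using T0 N by (intro power_strict_mono) auto
      ultimately show ?thesis by linarith
    qed
    obtain Q where Q: "finite Q" "T0 ^ N \<le> real (card Q)" "\<And>q. q \<in> Q \<Longrightarrow> int_coeffs q"
       "\<And>q. q \<in> Q \<Longrightarrow> \<exists>c. q = (\<Sum>k<N. Polynomial.smult (c k) (p k)) \<and> (\<forall>k<N. \<bar>c k\<bar> \<le> s k)"
      using many_integer_polys_in_box[OF p s(1) T_less] by blast
    have Q_deg: "coeff q k = 0" if q: "q \<in> Q" and k: "k \<ge> N" for q k
    proof -
      obtain c where "q = (\<Sum>k<N. Polynomial.smult (c k) (p k))" using Q(4)[OF q] by blast
      thus ?thesis using k by (auto simp: coeff_sum p coeff_eq_0 intro!: sum.neutral)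
    qed
    define J :: "(nat + nat) set" where "J = {..<M} <+> {..<M}"
    define a where "a q = case_sum (\<lambda>m. newton (coeff q) N m / A ^ m)
        (\<lambda>m. newton (reflect_coeffs (coeff q) N) N m / B ^ m)" for q
    have sumJ: "(\<Sum>j\<in>J. (a q j)\<^sup>2) = (\<Sum>m<M. (newton (coeff q) N m / A ^ m)\<^sup>2)
        + (\<Sum>m<M. (newton (reflect_coeffs (coeff q) N) N m / B ^ m)\<^sup>2)" for q
      unfolding J_def a_def by (subst sum.Plus) auto
    have small: "(\<Sum>j\<in>J. (a q j)\<^sup>2) \<le> t\<^sup>2 * real N / 4" if q: "q \<in> Q" for q
    proof -
      obtain c where c: "q = (\<Sum>k<N. Polynomial.smult (c k) (p k))" "\<And>k. k < N \<Longrightarrow> \<bar>c k\<bar> \<le> s k"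
        using Q(4)[OF q] by blast
      have "(\<Sum>j\<in>J. (a q j)\<^sup>2) \<le> 4 * (\<Sum>k<N. (c k)\<^sup>2 * h k)"
        using add_mono[OF KA(2)[rule_format, OF N MA, of "coeff q"] KB(2)[rule_format, OF N MB, of "reflect_coeffs (coeff q) N"]]
        unfolding sumJ pyth[rule_format, OF c(1), symmetric] by (simp add: distrib_left)
      also have "\<dots> \<le> 4 * (\<Sum>k<N. R)"
      proof (intro mult_left_mono sum_mono)
        fix k assume "k \<in> {..<N}"
        hence k: "k < N" by simp
        have "(c k)\<^sup>2 \<le> (s k)\<^sup>2" using c(2)[OF k] s(1)[OF k] by (intro iffD1[OF abs_le_square_iff]) simp
        hence "(c k)\<^sup>2 * h k \<le> (R / h k) * h k" using h[OF k] s(2)[OF k] by (intro mult_right_mono) auto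
        thus "(c k)\<^sup>2 * h k \<le> R" using h[OF k] by simp
      qed simp
      also have "\<dots> = t\<^sup>2 * real N / 4" by (simp add: t)
      finally show ?thesis .
    qed
    have finJ: "finite J" by (simp add: J_def)
    have cardJ: "card J = 2 * K * N" by (simp add: J_def M_def card_Plus)
    \<comment> \<open>the number of rounded vectors in \<open>2 * M\<close> coordinates, times the gain \<open>2 ^ N\<close>\<close>
    have "2 ^ N * (2 ^ N * 3 ^ card J) = T0 ^ N"
    proof -
      have "(3::real) ^ (2 * K * N) = (9 ^ K) ^ N" by (simp add: power_mult)
      moreover have "(2::real) ^ N * 2 ^ N = 4 ^ N" by (simp flip: power_mult_distrib)
      ultimately show ?thesis unfolding cardJ T0_def power_mult_distrib by (simp add: mult.assoc[symmetric])
    qed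
    hence many: "2 ^ N * (2 ^ N * 3 ^ card J) \<le> real (card Q)" using Q(2) by simp
    obtain F where F: "F \<subseteq> Q" "2 ^ N \<le> real (card F)" "\<And>q q' j. q \<in> F \<Longrightarrow> q' \<in> F \<Longrightarrow> j \<in> J \<Longrightarrow> \<bar>a q j - a q' j\<bar> \<le> t"
      using close_subset_exists[where a = a, OF Q(1) finJ t(1) small many] by blast
    have "(0::real) < 2 ^ N" by simp
    hence "F \<noteq> {}" using F(2) by auto
    then obtain q0 where q0: "q0 \<in> F" by blast
    define G where "G = (\<lambda>q. q - q0) ` F"
    have "finite G" using F(1) Q(1) by (auto simp: G_def intro: finite_subset)
    moreover have "card G = card F" unfolding G_def by (intro card_image) (auto simp: inj_on_def)
    hence "real (2 ^ N) \<le> real (card G)" using F(2) by simp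
    hence "2 ^ N \<le> card G" by (simp only: of_nat_le_iff)
    moreover have "g \<in> bounded_integer_polys A B t N" if g: "g \<in> G" for g
    proof -
      from g obtain q where q: "q \<in> F" "g = q - q0" by (auto simp: G_def)
      have qQ: "q \<in> Q" "q0 \<in> Q" using q(1) q0 F(1) by auto
      have "int_coeffs g" using Q(3)[OF qQ(1)] Q(3)[OF qQ(2)] by (auto simp: int_coeffs_def q(2))
      moreover have "\<forall>k\<ge>N. coeff g k = 0" using Q_deg[OF qQ(1)] Q_deg[OF qQ(2)] by (simp add: q(2))
      moreover have "\<bar>newton (coeff g) N m\<bar> \<le> t * A ^ m" for m
      proof (rule KA(3)[rule_format, OF N MA])
        fix m assume "m < M"
        hence "\<bar>a q (Inl m) - a q0 (Inl m)\<bar> \<le> t" by (intro F(3) q q0) (auto simp: J_def)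
        hence "\<bar>newton (coeff g) N m\<bar> / A ^ m \<le> t"
          using A by (simp add: a_def q(2) newton_diff diff_divide_distrib[symmetric] abs_div)
        thus "\<bar>newton (coeff g) N m\<bar> \<le> t * A ^ m" using A by (simp add: field_simps)
      qed
      moreover have "\<bar>newton (reflect_coeffs (coeff g) N) N m\<bar> \<le> t * B ^ m" for m
      proof (rule KB(3)[rule_format, OF N MB])
        fix m assume "m < M"
        hence "\<bar>a q (Inr m) - a q0 (Inr m)\<bar> \<le> t" by (intro F(3) q q0) (auto simp: J_def)
        hence "\<bar>newton (reflect_coeffs (coeff g) N) N m\<bar> / B ^ m \<le> t"
          using B by (simp add: a_def q(2) reflect_coeffs_diff diff_divide_distrib[symmetric] abs_div)
        thus "\<bar>newton (reflect_coeffs (coeff g) N) N m\<bar> \<le> t * B ^ m" using B by (simp add: field_simps)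
      qed
      ultimately show ?thesis by (simp add: bounded_integer_polys_def)
    qed
    ultimately show ?thesis by blast
  qed
  thus ?thesis using t(1) by blast
qed

text \<open>
  Distinct integer polynomials encode distinct integer-valued polynomials, so a finite solution set
  would contradict the lower bound \<open>2^N\<close> for a sufficiently large \<open>N\<close>.
\<close>

theorem theorem2p2:
  fixes A B :: real
  assumes "A > 1" and "B > 1" and "gamma_AB A B = 1"
  shows "\<exists>C\<^sub>1::real. C\<^sub>1 > 0 \<and>
    infinite {P :: real poly. integer_valued P \<and>
      (\<forall>n::nat. \<bar>poly P (of_nat n)\<bar> \<le> C\<^sub>1 * A ^ n) \<and>
      (\<forall>n::nat. n \<ge> 1 \<longrightarrow> \<bar>poly P (- of_nat n)\<bar> \<le> C\<^sub>1 * B ^ n)}"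
proof -
  obtain t where t: "t > 0"
    and many: "\<forall>N>0. \<exists>F \<subseteq> bounded_integer_polys A B t N. finite F \<and> 2 ^ N \<le> card F"
    using many_bounded_integer_polys[OF assms] by blast
  define S where "S = {P :: real poly. integer_valued P \<and>
      (\<forall>n::nat. \<bar>poly P (of_nat n)\<bar> \<le> t * A ^ n) \<and>
      (\<forall>n::nat. n \<ge> 1 \<longrightarrow> \<bar>poly P (- of_nat n)\<bar> \<le> t * B ^ n)}"
  have "infinite S"
  proof
    assume fin: "finite S"
    define N where "N = Suc (card S)"
    have "N > 0" by (simp add: N_def)
    with many have "\<exists>F \<subseteq> bounded_integer_polys A B t N. finite F \<and> 2 ^ N \<le> card F" by simp
    then obtain F where F_sub: "F \<subseteq> bounded_integer_polys A B t N" and F_card: "2 ^ N \<le> card F"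
      by blast
    have F: "int_coeffs q" "\<And>k. k \<ge> N \<Longrightarrow> coeff q k = 0"
      "\<And>m. \<bar>newton (coeff q) N m\<bar> \<le> t * A ^ m"
      "\<And>m. \<bar>newton (reflect_coeffs (coeff q) N) N m\<bar> \<le> t * B ^ m" if "q \<in> F" for q
      using that F_sub by (auto simp: bounded_integer_polys_def)
    let ?P = "\<lambda>q. newton_poly (coeff q) N"
    have "inj_on ?P F"
    proof (rule inj_onI)
      fix q q' assume q: "q \<in> F" "q' \<in> F" "?P q = ?P q'"
      have zero: "newton (coeff (q - q')) N m = 0" for m
      proof -
        have "newton (coeff q) N m = newton (coeff q') N m"
          using q(3) by (simp only: poly_newton_poly_nat[symmetric])
        thus ?thesis by (simp add: newton_diff)
      qed
      have "coeff (q - q') k = 0" for k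
      proof (cases "k < N")
        case True
        have "\<bar>coeff (q - q') k\<bar> \<le> 0 * (1 + 1) ^ k"
          by (rule newton_coeff_bound[of 1 N]) (simp_all add: zero True del: coeff_diff)
        thus ?thesis by simp
      next
        case False
        thus ?thesis using F(2)[OF q(1)] F(2)[OF q(2)] by simp
      qed
      thus "q = q'" by (simp add: poly_eq_iff)
    qed
    moreover have "?P ` F \<subseteq> S"
    proof
      fix P assume "P \<in> ?P ` F"
      then obtain q where q: "q \<in> F" "P = ?P q" by blast
      have "integer_valued P"
        unfolding integer_valued_def q(2) poly_newton_poly_nat newton_def
        using F(1)[OF q(1)] by (intro allI Ints_sum Ints_mult) (simp_all add: int_coeffs_def)
      moreover have "\<bar>poly P (of_nat n)\<bar> \<le> t * A ^ n" for n
        unfolding q(2) poly_newton_poly_nat by (rule F(3)[OF q(1)])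
      moreover have "\<bar>poly P (- of_nat n)\<bar> \<le> t * B ^ n" if n: "n \<ge> 1" for n
      proof -
        obtain m where m: "n = Suc m" using n by (cases n) auto
        have "\<bar>poly P (- of_nat n)\<bar> \<le> t * B ^ m"
          unfolding q(2) m poly_newton_poly_negative by (rule F(4)[OF q(1)])
        also have "\<dots> \<le> t * B ^ n" using t assms(2) mult_left_mono[of 1 B "B ^ m"] by (simp add: m mult_ac)
        finally show ?thesis .
      qed
      ultimately show "P \<in> S" by (simp add: S_def)
    qed
    ultimately have "card F \<le> card S" using card_mono[OF fin, of "?P ` F"] by (simp only: card_image)
    moreover have "card S < 2 ^ N" unfolding N_def
      using less_exp[of "Suc (card S)"] by linarith
    ultimately show False using F_card by linarith
  qed
  with t have "t > 0 \<and> infinite S" by simp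
  thus ?thesis unfolding S_def by (rule exI)
qed

end
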